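(* Let $V$ be a $*$-locally convex space and let $\{K_n\}$ be an $L^1$-matrix convex set in $V$ such that $M_n(V)^+:=\bigcup_{r=1}^\infty rK_n$ is a cone in $M_n(V)_{sa}$ for all $n$ and $V^+:=M_1(V)^+$ is proper and generating. Then $\left(A_0(K_1,V),\{M_n(A_0(K_1,V))^+\},\{\|\cdot\|_n\}\right)$ is a C$^*$-ordered operator space.
   Context: A $*$-locally convex space is a (Hausdorff) complex locally convex space $V$ with an involution $*$ that is a homeomorphism; $M_n(V)$ has the product topology and involution $[v_{ij}]^*=[v_{ji}^*]$; $V_{sa}$ denotes self-adjoint elements. A cone is a subset of the self-adjoint part closed under addition and multiplication by nonnegative reals; it is proper if $C\cap(-C)=\{0\}$ and generating if it spans the whole space. For a compact convex set $K$ with $0$ an extreme point of $K$, $\operatorname{lead}(K)$ is the set of $k\in K$ such that whenever $k=\alpha k_1$ with $k_1\in K$, $\alpha\in[0,1]$, then $\alpha=1$. A collection $\{K_n\}$ of compact convex sets $K_n\subseteq M_n(V)_{sa}$ with $0$ an extreme point of each $K_n$ is an $L^1$-matrix convex set if: (L1) if $u\in K_n$ and $\gamma_i$ are complex $n\times n_i$ matrices with $\sum_{i=1}^k\gamma_i\gamma_i^*\le I_n$, then $\bigoplus_{i=1}^k\gamma_i^*u\gamma_i\in K_{\sum n_i}$; (L2) if $u=\begin{bmatrix}u_{11}&u_{12}\\ u_{12}^*&u_{22}\end{bmatrix}\in K_{2n}$ with $u_{11},u_{22}\in K_n$, $u_{12}\in M_n(V)$, then $u_{12}+u_{12}^*\in\operatorname{co}(K_n\cup-K_n)$;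 (L3) if $u=\begin{bmatrix}u_{11}&u_{12}\\ u_{12}^*&u_{22}\end{bmatrix}\in K_{m+n}$ with $u_{11}\in K_m$, $u_{22}\in K_n$, $u_{12}\in M_{m,n}(V)$, and $u_{11}=\alpha_1\widehat{u_{11}}$, $u_{22}=\alpha_2\widehat{u_{22}}$ with $\alpha_1,\alpha_2\in[0,1]$, $\widehat{u_{11}}\in\operatorname{lead}(K_m)$, $\widehat{u_{22}}\in\operatorname{lead}(K_n)$, then $\alpha_1+\alpha_2\le1$. $A_0(K_n,M_n(V))$ is the space of continuous affine $a:K_n\to\mathbb{C}$ with $a(0)=0$ that extend to a continuous linear functional $\tilde a:M_n(V)\to\mathbb{C}$ (the extension is unique). Its involution is $a^*(u)=\overline{a(u)}$, $u\in K_n$ (so $\widetilde{a^*}(u)=\overline{\tilde a(u^* )}$ for $u\in M_n(V)$). For $a\in A_0(K_n,M_n(V))$, $\|a\|_{\infty,n}=\sup\{|\tilde a(u_{12})+\widetilde{a^*}(u_{12}^* )|: u=\begin{bmatrix}u_{11}&u_{12}\\ u_{12}^*&u_{22}\end{bmatrix}\in K_{2n}\}$. Define $\Phi_n:M_n(A_0(K_1,V))\to A_0(K_n,M_n(V))$ by $\Phi_n([a_{ij}])([v_{ij}])=\sum_{i,j=1}^n\widetilde{a_{ij}}(v_{ij})$ for $[v_{ij}]\in K_n$. The involution on $M_n(A_0(K_1,V))$ is $[a_{ij}]^*=[a_{ji}^*]$; $M_n(A_0(K_1,V))^+$ is the set of self-adjoint $[a_{ij}]$ with $\sum_{i,j}\widetilde{a_{ij}}(v_{ij})\ge0$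 for all $[v_{ij}]\in K_n$; and $\|[a_{ij}]\|_n=\|\Phi_n([a_{ij}])\|_{\infty,n}$. A complex $*$-vector space $W$ is matrix ordered if each $M_n(W)_{sa}$ carries a cone $M_n(W)^+$ with $\gamma^*M_m(W)^+\gamma\subseteq M_n(W)^+$ for all scalar $m\times n$ matrices $\gamma$; $u\le v$ means $v-u\in M_n(W)^+$. An abstract operator space is a complex vector space $W$ with norms $\|\cdot\|_n$ on $M_n(W)$ such that $\|v\oplus w\|_{n+m}=\max\{\|v\|_n,\|w\|_m\}$ and $\|\alpha v\beta\|_n\le\|\alpha\|\,\|v\|_n\|\beta\|$ for scalar matrices $\alpha,\beta$. A C$^*$-ordered operator space is a matrix ordered $*$-vector space $W$ with matrix norms making it an abstract operator space, such that $M_1(W)^+$ is proper and for each $n$: $*$ is an isometry on $M_n(W)$; $M_n(W)^+$ is norm closed; and $\|g\|_n\le\max\{\|f\|_n,\|h\|_n\}$ whenever $f\le g\le h$ in $M_n(W)_{sa}$. *)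

theory Defs
  imports "HOL-Analysis.Analysis" "HOL-Library.Function_Algebras" "HOL-Library.Nonpos_Ints"
begin

section \<open>Complex vector spaces\<close>

text \<open>
  The real scalar multiplication of a complex vector space is the restriction of the complex one,
  so that the library notions \<open>convex\<close>, \<open>convex hull\<close> and \<open>extreme_point_of\<close> apply.
\<close>

class complex_vector = real_vector +
  fixes scaleC :: "complex \<Rightarrow> 'a \<Rightarrow> 'a"  (infixr "*\<^sub>C" 75)
  assumes scaleC_add_right: "c *\<^sub>C (x + y) = c *\<^sub>C x + c *\<^sub>C y"
    and scaleC_add_left: "(c + d) *\<^sub>C x = c *\<^sub>C x + d *\<^sub>C x"
    and scaleC_scaleC: "c *\<^sub>C (d *\<^sub>C x) = (c * d) *\<^sub>C x"
    and scaleC_one: "1 *\<^sub>C x = x"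
    and scaleR_scaleC: "r *\<^sub>R x = complex_of_real r *\<^sub>C x"

global_interpretation cvs: vector_space "scaleC :: complex \<Rightarrow> 'a \<Rightarrow> 'a::complex_vector"
  by unfold_locales (simp_all add: scaleC_add_right scaleC_add_left scaleC_scaleC scaleC_one)

instantiation complex :: complex_vector
begin
definition scaleC_complex :: "complex \<Rightarrow> complex \<Rightarrow> complex"
  where "scaleC_complex c x = c * x"
instance
  by standard (simp_all add: scaleC_complex_def algebra_simps scaleR_conv_of_real)
end

instantiation "fun" :: (type, real_vector) real_vector
begin
definition scaleR_fun :: "real \<Rightarrow> ('a \<Rightarrow> 'b) \<Rightarrow> 'a \<Rightarrow> 'b"
  where "scaleR_fun r f = (\<lambda>x. r *\<^sub>R f x)"
instance
  by standard (auto simp: scaleR_fun_def fun_eq_iff scaleR_add_right scaleR_add_left)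
end

instantiation "fun" :: (type, complex_vector) complex_vector
begin
definition scaleC_fun :: "complex \<Rightarrow> ('a \<Rightarrow> 'b) \<Rightarrow> 'a \<Rightarrow> 'b"
  where "scaleC_fun c f = (\<lambda>x. c *\<^sub>C f x)"
instance
  by standard (auto simp: scaleC_fun_def scaleR_fun_def fun_eq_iff scaleC_add_right
      scaleC_add_left scaleC_scaleC scaleC_one scaleR_scaleC)
end

text \<open>
  Being its own inverse, a continuous involution is a homeomorphism. The assumption
  \<open>locally_convex\<close> spells out \<open>convex\<close>, which cannot be used inside a class specification.
\<close>

class star_locally_convex = complex_vector + topological_ab_group_add + t2_space +
  fixes star :: "'a \<Rightarrow> 'a"
  assumes tendsto_scaleC_nhds:
      "LIM p (nhds c \<times>\<^sub>F nhds x). fst p *\<^sub>C snd p :> nhds (c *\<^sub>C x)"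
    and locally_convex: "open U \<Longrightarrow> 0 \<in> U \<Longrightarrow> \<exists>C. open C \<and> 0 \<in> C \<and> C \<subseteq> U \<and>
      (\<forall>x\<in>C. \<forall>y\<in>C. \<forall>r\<ge>0. \<forall>s\<ge>0. r + s = 1 \<longrightarrow> r *\<^sub>R x + s *\<^sub>R y \<in> C)"
    and star_star: "star (star x) = x"
    and star_add: "star (x + y) = star x + star y"
    and star_scaleC: "star (c *\<^sub>C x) = cnj c *\<^sub>C star x"
    and tendsto_star_nhds: "LIM y (nhds x). star y :> nhds (star x)"


section \<open>Matrices\<close>

text \<open>
  An $m \times n$ matrix is a function of two indices (counted from 0) vanishing outside
  $[0,m) \times [0,n)$. The topology of \<open>nat \<Rightarrow> nat \<Rightarrow> 'a\<close> is that of pointwise convergence, so it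
  restricts to the product topology on \<open>mats m n UNIV\<close>.
\<close>

type_synonym 'a mtx = "nat \<Rightarrow> nat \<Rightarrow> 'a"

definition mats :: "nat \<Rightarrow> nat \<Rightarrow> 'a::zero set \<Rightarrow> 'a mtx set" where
  "mats m n S = {v. (\<forall>i<m. \<forall>j<n. v i j \<in> S) \<and> (\<forall>i j. \<not> (i < m \<and> j < n) \<longrightarrow> v i j = 0)}"

definition adj :: "('a \<Rightarrow> 'a) \<Rightarrow> 'a mtx \<Rightarrow> 'a mtx" where
  "adj st v = (\<lambda>i j. st (v j i))"

definition sa_mats :: "('a \<Rightarrow> 'a) \<Rightarrow> nat \<Rightarrow> 'a::zero set \<Rightarrow> 'a mtx set" where
  "sa_mats st n S = {v \<in> mats n n S. adj st v = v}"

definition id_mat :: "nat \<Rightarrow> complex mtx" where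
  "id_mat n = (\<lambda>i j. if i = j \<and> i < n then 1 else 0)"

definition mat_prod :: "nat \<Rightarrow> complex mtx \<Rightarrow> complex mtx \<Rightarrow> complex mtx" where
  "mat_prod p A B = (\<lambda>i j. \<Sum>k<p. A i k * B k j)"

text \<open>The product $\alpha v \beta$ of scalar matrices with an $n \times n$ matrix $v$ of vectors.\<close>

definition sandwich :: "nat \<Rightarrow> complex mtx \<Rightarrow> 'a::complex_vector mtx \<Rightarrow> complex mtx \<Rightarrow> 'a mtx" where
  "sandwich n \<alpha> v \<beta> = (\<lambda>i j. \<Sum>k<n. \<Sum>l<n. (\<alpha> i k * \<beta> l j) *\<^sub>C v k l)"

text \<open>The block matrix with rows $(u_{11}, u_{12})$ and $(u_{21}, u_{22})$, where $u_{11}$ is $m \times m$.\<close>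

definition block :: "nat \<Rightarrow> 'a mtx \<Rightarrow> 'a mtx \<Rightarrow> 'a mtx \<Rightarrow> 'a mtx \<Rightarrow> 'a mtx" where
  "block m u11 u12 u21 u22 = (\<lambda>i j.
     if i < m then (if j < m then u11 i j else u12 i (j - m))
     else (if j < m then u21 (i - m) j else u22 (i - m) (j - m)))"

definition dsum :: "nat \<Rightarrow> 'a::zero mtx \<Rightarrow> 'a mtx \<Rightarrow> 'a mtx" where
  "dsum m v w = block m v (\<lambda>i j. 0) (\<lambda>i j. 0) w"

fun dsum_list :: "(nat \<times> 'a::zero mtx) list \<Rightarrow> 'a mtx" where
  "dsum_list [] = (\<lambda>i j. 0)"
| "dsum_list ((n, v) # vs) = dsum n v (dsum_list vs)"

definition psd :: "nat \<Rightarrow> complex mtx \<Rightarrow> bool" where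
  "psd n A \<longleftrightarrow> (\<forall>x :: nat \<Rightarrow> complex. (\<Sum>i<n. \<Sum>j<n. cnj (x i) * A i j * x j) \<in> \<real>\<^sub>\<ge>\<^sub>0)"

text \<open>The operator norm of an $n \times n$ scalar matrix with respect to the Euclidean norm.\<close>

definition op_norm :: "nat \<Rightarrow> complex mtx \<Rightarrow> real" where
  "op_norm n A = Sup {L2_set (\<lambda>i. cmod (\<Sum>j<n. A i j * x j)) {..<n} | x.
     L2_set (\<lambda>j. cmod (x j)) {..<n} \<le> 1}"


section \<open>Cones and C*-ordered operator spaces\<close>

definition is_cone :: "'a::real_vector set \<Rightarrow> 'a set \<Rightarrow> bool" where
  "is_cone S C \<longleftrightarrow> C \<subseteq> S \<and> (\<forall>x\<in>C. \<forall>y\<in>C. x + y \<in> C) \<and> (\<forall>x\<in>C. \<forall>r\<ge>0. r *\<^sub>R x \<in> C)"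

definition proper :: "'a::real_vector set \<Rightarrow> bool" where
  "proper C \<longleftrightarrow> C \<inter> uminus ` C = {0}"

text \<open>
  The space is carried by a complex subspace \<open>W\<close> of the ambient type; the involution, the cones
  and the norms matter only on (matrices over) \<open>W\<close>, and only for matrix sizes \<open>n \<ge> 1\<close>.
\<close>

definition star_vector_space :: "'w::complex_vector set \<Rightarrow> ('w \<Rightarrow> 'w) \<Rightarrow> bool" where
  "star_vector_space W st \<longleftrightarrow> cvs.subspace W \<and>
     (\<forall>x\<in>W. st x \<in> W \<and> st (st x) = x) \<and>
     (\<forall>x\<in>W. \<forall>y\<in>W. st (x + y) = st x + st y) \<and>
     (\<forall>x\<in>W. \<forall>c. st (c *\<^sub>C x) = cnj c *\<^sub>C st x)"

definition matrix_ordered ::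
  "'w::complex_vector set \<Rightarrow> ('w \<Rightarrow> 'w) \<Rightarrow> (nat \<Rightarrow> 'w mtx set) \<Rightarrow> bool" where
  "matrix_ordered W st P \<longleftrightarrow> star_vector_space W st \<and>
     (\<forall>n\<ge>1. is_cone (sa_mats st n W) (P n)) \<and>
     (\<forall>m\<ge>1. \<forall>n\<ge>1. \<forall>\<gamma>\<in>mats m n UNIV. \<forall>v\<in>P m. sandwich m (adj cnj \<gamma>) v \<gamma> \<in> P n)"

definition norm_on :: "'a::complex_vector set \<Rightarrow> ('a \<Rightarrow> real) \<Rightarrow> bool" where
  "norm_on S N \<longleftrightarrow>
     (\<forall>x\<in>S. 0 \<le> N x \<and> (N x = 0 \<longleftrightarrow> x = 0)) \<and>
     (\<forall>x\<in>S. \<forall>c. N (c *\<^sub>C x) = cmod c * N x) \<and>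
     (\<forall>x\<in>S. \<forall>y\<in>S. N (x + y) \<le> N x + N y)"

definition operator_space ::
  "'w::complex_vector set \<Rightarrow> (nat \<Rightarrow> 'w mtx \<Rightarrow> real) \<Rightarrow> bool" where
  "operator_space W N \<longleftrightarrow> cvs.subspace W \<and>
     (\<forall>n\<ge>1. norm_on (mats n n W) (N n)) \<and>
     (\<forall>n\<ge>1. \<forall>m\<ge>1. \<forall>v\<in>mats n n W. \<forall>w\<in>mats m m W.
        N (n + m) (dsum n v w) = max (N n v) (N m w)) \<and>
     (\<forall>n\<ge>1. \<forall>v\<in>mats n n W. \<forall>\<alpha>\<in>mats n n UNIV. \<forall>\<beta>\<in>mats n n UNIV.
        N n (sandwich n \<alpha> v \<beta>) \<le> op_norm n \<alpha> * N n v * op_norm n \<beta>)"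

definition cstar_ordered_operator_space ::
  "'w::complex_vector set \<Rightarrow> ('w \<Rightarrow> 'w) \<Rightarrow> (nat \<Rightarrow> 'w mtx set) \<Rightarrow> (nat \<Rightarrow> 'w mtx \<Rightarrow> real) \<Rightarrow> bool" where
  "cstar_ordered_operator_space W st P N \<longleftrightarrow>
     matrix_ordered W st P \<and> operator_space W N \<and> proper (P 1) \<and>
     (\<forall>n\<ge>1.
        (\<forall>v\<in>mats n n W. N n (adj st v) = N n v) \<and>
        (\<forall>v\<in>mats n n W. (\<forall>\<epsilon>>0. \<exists>w\<in>P n. N n (v - w) < \<epsilon>) \<longrightarrow> v \<in> P n) \<and>
        (\<forall>f\<in>sa_mats st n W. \<forall>g\<in>sa_mats st n W. \<forall>h\<in>sa_mats st n W.
           g - f \<in> P n \<and> h - g \<in> P n \<longrightarrow> N n g \<le> max (N n f) (N n h)))"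


section \<open>$L^1$-matrix convex sets\<close>

definition lead :: "'a::real_vector set \<Rightarrow> 'a set" where
  "lead K = {k\<in>K. \<forall>\<alpha>\<in>{0..1}. \<forall>k1\<in>K. k = \<alpha> *\<^sub>R k1 \<longrightarrow> \<alpha> = 1}"

text \<open>In the first condition, \<open>\<gamma>s\<close> is the list of the pairs $(n_i, \gamma_i)$.\<close>

definition L1_cond :: "(nat \<Rightarrow> 'v::star_locally_convex mtx set) \<Rightarrow> bool" where
  "L1_cond K \<longleftrightarrow>
     (\<forall>n\<ge>1. \<forall>u\<in>K n. \<forall>\<gamma>s :: (nat \<times> complex mtx) list.
        \<gamma>s \<noteq> [] \<and> (\<forall>(p, \<gamma>)\<in>set \<gamma>s. 1 \<le> p \<and> \<gamma> \<in> mats n p UNIV) \<and>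
        psd n (id_mat n - (\<Sum>(p, \<gamma>)\<leftarrow>\<gamma>s. mat_prod p \<gamma> (adj cnj \<gamma>))) \<longrightarrow>
        dsum_list (map (\<lambda>(p, \<gamma>). (p, sandwich n (adj cnj \<gamma>) u \<gamma>)) \<gamma>s) \<in> K (\<Sum>(p, \<gamma>)\<leftarrow>\<gamma>s. p))"

definition L2_cond :: "(nat \<Rightarrow> 'v::star_locally_convex mtx set) \<Rightarrow> bool" where
  "L2_cond K \<longleftrightarrow>
     (\<forall>n\<ge>1. \<forall>u11\<in>K n. \<forall>u22\<in>K n. \<forall>u12\<in>mats n n UNIV.
        block n u11 u12 (adj star u12) u22 \<in> K (2 * n) \<longrightarrow>
        u12 + adj star u12 \<in> convex hull (K n \<union> uminus ` K n))"

definition L3_cond :: "(nat \<Rightarrow> 'v::star_locally_convex mtx set) \<Rightarrow> bool" where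
  "L3_cond K \<longleftrightarrow>
     (\<forall>m\<ge>1. \<forall>n\<ge>1. \<forall>u11\<in>K m. \<forall>u22\<in>K n. \<forall>u12\<in>mats m n UNIV.
        \<forall>\<alpha>1\<in>{0..1}. \<forall>\<alpha>2\<in>{0..1}. \<forall>w11\<in>lead (K m). \<forall>w22\<in>lead (K n).
        block m u11 u12 (adj star u12) u22 \<in> K (m + n) \<and>
        u11 = \<alpha>1 *\<^sub>R w11 \<and> u22 = \<alpha>2 *\<^sub>R w22 \<longrightarrow> \<alpha>1 + \<alpha>2 \<le> 1)"

definition L1_matrix_convex :: "(nat \<Rightarrow> 'v::star_locally_convex mtx set) \<Rightarrow> bool" where
  "L1_matrix_convex K \<longleftrightarrow>
     (\<forall>n\<ge>1. K n \<subseteq> sa_mats star n UNIV \<and> compact (K n) \<and> convex (K n) \<and> 0 extreme_point_of (K n)) \<and>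
     L1_cond K \<and> L2_cond K \<and> L3_cond K"

definition pos_mats :: "(nat \<Rightarrow> 'v::star_locally_convex mtx set) \<Rightarrow> nat \<Rightarrow> 'v mtx set" where
  "pos_mats K n = (\<Union>r\<in>{1::nat..}. (\<lambda>u. real r *\<^sub>R u) ` K n)"


section \<open>The spaces of affine functions\<close>

text \<open>
  \<open>X\<close> is the vector space containing the compact convex set \<open>K\<close>. Functions on \<open>X\<close> or \<open>K\<close> are
  represented by functions on the whole type that vanish off \<open>X\<close> or \<open>K\<close>, respectively.
\<close>

definition extends_to :: "'x::{complex_vector, topological_space} set \<Rightarrow> 'x set \<Rightarrow>
    ('x \<Rightarrow> complex) \<Rightarrow> ('x \<Rightarrow> complex) \<Rightarrow> bool" where
  "extends_to X K a f \<longleftrightarrow>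
     (\<forall>x. x \<notin> X \<longrightarrow> f x = 0) \<and>
     (\<forall>x\<in>X. \<forall>y\<in>X. f (x + y) = f x + f y) \<and>
     (\<forall>x\<in>X. \<forall>c. f (c *\<^sub>C x) = c * f x) \<and>
     continuous_on X f \<and> (\<forall>x\<in>K. f x = a x)"

definition A0 :: "'x::{complex_vector, topological_space} set \<Rightarrow> 'x set \<Rightarrow> ('x \<Rightarrow> complex) set" where
  "A0 X K = {a.
     (\<forall>x. x \<notin> K \<longrightarrow> a x = 0) \<and> continuous_on K a \<and>
     (\<forall>x\<in>K. \<forall>y\<in>K. \<forall>t\<in>{0..1::real}.
        a ((1 - t) *\<^sub>R x + t *\<^sub>R y) = of_real (1 - t) * a x + of_real t * a y) \<and>
     a 0 = 0 \<and> (\<exists>f. extends_to X K a f)}"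

text \<open>The extension $\tilde a$. It is unique when \<open>K\<close> spans \<open>X\<close>.\<close>

definition ext :: "'x::{complex_vector, topological_space} set \<Rightarrow> 'x set \<Rightarrow>
    ('x \<Rightarrow> complex) \<Rightarrow> 'x \<Rightarrow> complex" where
  "ext X K a = (THE f. extends_to X K a f)"

definition fun_star :: "('x \<Rightarrow> complex) \<Rightarrow> 'x \<Rightarrow> complex" where
  "fun_star a = (\<lambda>u. cnj (a u))"

definition inf_norm :: "(nat \<Rightarrow> 'v::star_locally_convex mtx set) \<Rightarrow> nat \<Rightarrow> ('v mtx \<Rightarrow> complex) \<Rightarrow> real" where
  "inf_norm K n a = Sup {cmod (ext (mats n n UNIV) (K n) a u12 +
        ext (mats n n UNIV) (K n) (fun_star a) (adj star u12)) | u11 u12 u22.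
     u11 \<in> mats n n UNIV \<and> u12 \<in> mats n n UNIV \<and> u22 \<in> mats n n UNIV \<and>
     block n u11 u12 (adj star u12) u22 \<in> K (2 * n)}"

text \<open>$K_1$ as a subset of $V$, under the identification of $M_1(V)$ with $V$.\<close>

definition base :: "(nat \<Rightarrow> 'v mtx set) \<Rightarrow> 'v set" where
  "base K = (\<lambda>v. v 0 0) ` K 1"

definition A0_V :: "(nat \<Rightarrow> 'v::star_locally_convex mtx set) \<Rightarrow> ('v \<Rightarrow> complex) set" where
  "A0_V K = A0 UNIV (base K)"

definition pairing :: "(nat \<Rightarrow> 'v::star_locally_convex mtx set) \<Rightarrow> nat \<Rightarrow>
    ('v \<Rightarrow> complex) mtx \<Rightarrow> 'v mtx \<Rightarrow> complex" where
  "pairing K n a v = (\<Sum>i<n. \<Sum>j<n. ext UNIV (base K) (a i j) (v i j))"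

definition Phi :: "(nat \<Rightarrow> 'v::star_locally_convex mtx set) \<Rightarrow> nat \<Rightarrow>
    ('v \<Rightarrow> complex) mtx \<Rightarrow> 'v mtx \<Rightarrow> complex" where
  "Phi K n a = (\<lambda>v. if v \<in> K n then pairing K n a v else 0)"

definition A0_pos :: "(nat \<Rightarrow> 'v::star_locally_convex mtx set) \<Rightarrow> nat \<Rightarrow> ('v \<Rightarrow> complex) mtx set" where
  "A0_pos K n = {a \<in> sa_mats fun_star n (A0_V K). \<forall>v\<in>K n. pairing K n a v \<in> \<real>\<^sub>\<ge>\<^sub>0}"

definition A0_norm :: "(nat \<Rightarrow> 'v::star_locally_convex mtx set) \<Rightarrow> nat \<Rightarrow>
    ('v \<Rightarrow> complex) mtx \<Rightarrow> real" where
  "A0_norm K n a = inf_norm K n (Phi K n a)"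

end

theory Submission
  imports Defs
begin

text \<open>
  The idea is to rewrite the norm as a supremum over \<open>K (2 * n)\<close> that only involves the upper right
  corner. Write $\langle a, v\rangle = \sum_{ij} \tilde a_{ij}(v_{ij})$ for the pairing. For
  $u \in K_{2n}$ with upper right corner $u_{12}$ the quantity in the definition of the norm is
  $|\langle a, u_{12}\rangle + \overline{\langle a, u_{12}\rangle}|$; this uses that the extension of
  \<open>Phi K n a\<close> to all matrices is the pairing, which holds because \<open>K n\<close> spans all matrices (\<open>span_K\<close>,
  by polarization from \<open>K 1\<close>). Conjugating $u$ by the unitary $\mathrm{diag}(1, d)$ multiplies $u_{12}$
  by the phase $d$, so
  \[ \|a\|_n = \sup_{u \in K_{2n}} 2\,|\langle a, u_{12}\rangle|
             = \sup_{u \in K_{2n}} 2\,\mathrm{Re}\,\langle a, u_{12}\rangle . \]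
  The two halves of this formula, \<open>A0_norm_upper\<close> and \<open>A0_norm_least\<close>, are the interface through
  which all properties of the norm are proved.

  Almost all axioms then follow by transporting elements of one \<open>K n\<close> to another by
  $u \mapsto \gamma^* u \gamma$ with $\gamma$ a contraction (\<open>compress\<close>, the case of the first condition with
  one $\gamma$). Definiteness of the norm uses $\gamma$ with one row; invariance under the involution uses
  the swap of the two blocks; the bound $\|\alpha a \beta\| \le \|\alpha\| \|a\| \|\beta\|$ uses the block diagonal
  matrix built from $\bar\alpha/\|\alpha\|$ and $\beta^T/\|\beta\|$; and
  $|\langle a, u\rangle| \le \|a\|_n$ for $u \in K_n$ (\<open>A0_norm_bound\<close>), which makes the cones closed, uses
  $\gamma = (I, I)/\sqrt 2$.

  Two axioms need the other conditions. For $\|a \oplus b\| \le \max(\|a\|, \|b\|)$, pinching an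
  element of $K_{2(n+m)}$ gives $x \oplus y \in K_{2n+2m}$, and
  $\langle a \oplus b, u_{12}\rangle = \langle a, x_{12}\rangle + \langle b, y_{12}\rangle$. By
  compactness $x = \alpha \hat x$ and $y = \beta \hat y$ with lead points $\hat x$, $\hat y$, and the
  third condition gives $\alpha + \beta \le 1$, so the sum of the two contributions is at most the maximum.
  For $f \le g \le h$, the second condition puts $u_{12} + u_{12}^*$ into the convex hull of
  $K_n \cup -K_n$, and there the real functional $\langle g, \cdot\rangle$ is bounded by its values on $K_n$,
  at most $\|h\|$, and on $-K_n$, at most $\|f\|$.
\<close>

section \<open>Pointwise operations and continuity\<close>

lemma sum_fun_apply: "(\<Sum>i\<in>I. f i) x = (\<Sum>i\<in>I. (f i :: 'b \<Rightarrow> 'c::comm_monoid_add) x)"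
  by (induction I rule: infinite_finite_induct) auto

lemma scaleC_fun_apply: "(c *\<^sub>C f) x = c *\<^sub>C f x"
  by (simp add: scaleC_fun_def)

lemma scaleR_fun_apply: "(r *\<^sub>R f) x = r *\<^sub>R f x"
  by (simp add: scaleR_fun_def)

lemma continuous_on_scaleC [continuous_intros]:
  fixes g :: "'b::topological_space \<Rightarrow> 'v::star_locally_convex"
  assumes "continuous_on S f" "continuous_on S g"
  shows "continuous_on S (\<lambda>x. f x *\<^sub>C g x)"
  unfolding continuous_on_def
proof
  fix x assume "x \<in> S"
  then have "filterlim (\<lambda>y. (f y, g y)) (nhds (f x) \<times>\<^sub>F nhds (g x)) (at x within S)"
    using assms by (auto simp: continuous_on_def intro!: filterlim_Pair)
  from filterlim_compose[OF tendsto_scaleC_nhds this]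
  show "((\<lambda>x. f x *\<^sub>C g x) \<longlongrightarrow> f x *\<^sub>C g x) (at x within S)"
    by simp
qed

lemma continuous_on_star: "continuous_on S (star :: 'v::star_locally_convex \<Rightarrow> 'v)"
  unfolding continuous_on_def using tendsto_star_nhds at_within_le_nhds tendsto_mono by blast

lemma star_zero: "star 0 = (0 :: 'v::star_locally_convex)"
  using star_scaleC[of 0 "0::'v"] by simp

section \<open>Contractive scalar matrices\<close>

text \<open>
  Since $x^* \gamma \gamma^* x = \|\gamma^* x\|^2$, contractivity of $\gamma^*$ is exactly the positivity
  of $I - \gamma \gamma^*$ that the first condition on \<open>K\<close> asks for.
\<close>

lemma psd_id_minus:
  assumes "\<And>x. (\<Sum>k<p. (cmod (\<Sum>i<n. cnj (\<gamma> i k) * x i))\<^sup>2) \<le> (\<Sum>i<n. (cmod (x i))\<^sup>2)"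
  shows "psd n (id_mat n - mat_prod p \<gamma> (adj cnj \<gamma>))"
  unfolding psd_def
proof
  fix x :: "nat \<Rightarrow> complex"
  define y where "y k = (\<Sum>i<n. cnj (\<gamma> i k) * x i)" for k
  have sq: "cnj z * z = of_real ((cmod z)\<^sup>2)" for z
    using complex_norm_square[of z] by (simp add: mult.commute)
  have "(\<Sum>i<n. \<Sum>j<n. cnj (x i) * (id_mat n - mat_prod p \<gamma> (adj cnj \<gamma>)) i j * x j)
      = (\<Sum>i<n. \<Sum>j<n. cnj (x i) * id_mat n i j * x j)
        - (\<Sum>i<n. \<Sum>j<n. cnj (x i) * mat_prod p \<gamma> (adj cnj \<gamma>) i j * x j)"
    by (simp add: algebra_simps sum_subtractf)
  also have "(\<Sum>i<n. \<Sum>j<n. cnj (x i) * id_mat n i j * x j) = (\<Sum>i<n. cnj (x i) * x i)"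
  proof (intro sum.cong refl)
    fix i assume "i \<in> {..<n}"
    then have "(\<Sum>j<n. cnj (x i) * id_mat n i j * x j) = (\<Sum>j<n. if i = j then cnj (x i) * x j else 0)"
      by (intro sum.cong) (auto simp: id_mat_def)
    then show "(\<Sum>j<n. cnj (x i) * id_mat n i j * x j) = cnj (x i) * x i"
      using \<open>i \<in> {..<n}\<close> by simp
  qed
  also have "(\<Sum>i<n. \<Sum>j<n. cnj (x i) * mat_prod p \<gamma> (adj cnj \<gamma>) i j * x j)
      = (\<Sum>i<n. \<Sum>j<n. \<Sum>k<p. (\<gamma> i k * cnj (x i)) * (cnj (\<gamma> j k) * x j))"
    by (simp add: mat_prod_def adj_def sum_distrib_left sum_distrib_right mult_ac)
  also have "\<dots> = (\<Sum>i<n. \<Sum>k<p. \<Sum>j<n. (\<gamma> i k * cnj (x i)) * (cnj (\<gamma> j k) * x j))"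
    by (intro sum.cong refl sum.swap)
  also have "\<dots> = (\<Sum>k<p. \<Sum>i<n. \<Sum>j<n. (\<gamma> i k * cnj (x i)) * (cnj (\<gamma> j k) * x j))"
    by (rule sum.swap)
  also have "\<dots> = (\<Sum>k<p. cnj (y k) * y k)"
  proof (intro sum.cong refl)
    fix k
    have "cnj (y k) = (\<Sum>i<n. \<gamma> i k * cnj (x i))" by (simp add: y_def)
    then show "(\<Sum>i<n. \<Sum>j<n. \<gamma> i k * cnj (x i) * (cnj (\<gamma> j k) * x j)) = cnj (y k) * y k"
      by (simp only: y_def sum_product)
  qed
  also have "(\<Sum>i<n. cnj (x i) * x i) - \<dots> =
      of_real ((\<Sum>i<n. (cmod (x i))\<^sup>2) - (\<Sum>k<p. (cmod (y k))\<^sup>2))"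
    by (simp add: sq)
  also have "\<dots> \<in> \<real>\<^sub>\<ge>\<^sub>0"
    using assms[of x] unfolding nonneg_Reals_of_real_iff y_def by simp
  finally show "(\<Sum>i<n. \<Sum>j<n. cnj (x i) * (id_mat n - mat_prod p \<gamma> (adj cnj \<gamma>)) i j * x j) \<in> \<real>\<^sub>\<ge>\<^sub>0" .
qed

text \<open>
  \<open>op_norm\<close> is a supremum of reals, so it says something only once the set is known to be bounded.
\<close>

lemma op_norm_bdd:
  fixes A :: "complex mtx" and n :: nat
  shows "bdd_above {L2_set (\<lambda>i. cmod (\<Sum>j<n. A i j * x j)) {..<n} | x. L2_set (\<lambda>j. cmod (x j)) {..<n} \<le> 1}"
proof (rule bdd_aboveI, safe)
  fix x :: "nat \<Rightarrow> complex" assume x: "L2_set (\<lambda>j. cmod (x j)) {..<n} \<le> 1"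
  have "L2_set (\<lambda>i. cmod (\<Sum>j<n. A i j * x j)) {..<n} \<le> (\<Sum>i<n. cmod (\<Sum>j<n. A i j * x j))"
    using L2_set_le_sum_abs[of "\<lambda>i. cmod (\<Sum>j<n. A i j * x j)" "{..<n}"] by simp
  also have "\<dots> \<le> (\<Sum>i<n. \<Sum>j<n. cmod (A i j))"
  proof (intro sum_mono)
    fix i assume "i \<in> {..<n}"
    have "cmod (\<Sum>j<n. A i j * x j) \<le> (\<Sum>j<n. cmod (A i j) * cmod (x j))"
      using norm_sum[of "\<lambda>j. A i j * x j" "{..<n}"] by (simp add: norm_mult)
    also have "\<dots> \<le> (\<Sum>j<n. cmod (A i j))"
    proof (intro sum_mono)
      fix j assume "j \<in> {..<n}"
      then have "cmod (x j) \<le> 1"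
        using member_le_L2_set[of "{..<n}" j "\<lambda>j. cmod (x j)"] x by auto
      then show "cmod (A i j) * cmod (x j) \<le> cmod (A i j)"
        using mult_left_le[of "cmod (x j)" "cmod (A i j)"] by simp
    qed
    finally show "cmod (\<Sum>j<n. A i j * x j) \<le> (\<Sum>j<n. cmod (A i j))" .
  qed
  finally show "L2_set (\<lambda>i. cmod (\<Sum>j<n. A i j * x j)) {..<n} \<le> (\<Sum>i<n. \<Sum>j<n. cmod (A i j))" .
qed

lemma op_norm_nonneg: "0 \<le> op_norm n A"
proof -
  have "L2_set (\<lambda>i. cmod (\<Sum>j<n. A i j * 0)) {..<n} \<le> op_norm n A"
    unfolding op_norm_def
    by (rule cSup_upper[OF _ op_norm_bdd]) (auto simp: L2_set_def intro!: exI[of _ "\<lambda>_. 0"])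
  then show ?thesis by (simp add: L2_set_def)
qed

lemma op_norm_bound:
  "L2_set (\<lambda>i. cmod (\<Sum>j<n. A i j * x j)) {..<n} \<le> op_norm n A * L2_set (\<lambda>j. cmod (x j)) {..<n}"
    (is "?L \<le> _ * ?r")
proof (cases "?r = 0")
  case True
  then have "x j = 0" if "j < n" for j
    using that member_le_L2_set[of "{..<n}" j "\<lambda>j. cmod (x j)"] by auto
  then show ?thesis by (simp add: True L2_set_def)
next
  case False
  define r where "r = ?r"
  have r: "r > 0" using False by (simp add: r_def L2_set_nonneg order_less_le)
  have scale: "L2_set (\<lambda>j. cmod (f j / of_real r)) {..<n} = L2_set (\<lambda>j. cmod (f j)) {..<n} / r" for f
    using r L2_set_left_distrib[of "1/r" "\<lambda>j. cmod (f j)" "{..<n}"] by (simp add: norm_divide)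
  have "L2_set (\<lambda>i. cmod (\<Sum>j<n. A i j * (x j / of_real r))) {..<n} \<le> op_norm n A"
    unfolding op_norm_def
  proof (rule cSup_upper[OF _ op_norm_bdd], safe)
    show "\<exists>z. L2_set (\<lambda>i. cmod (\<Sum>j<n. A i j * (x j / of_real r))) {..<n}
        = L2_set (\<lambda>i. cmod (\<Sum>j<n. A i j * z j)) {..<n} \<and> L2_set (\<lambda>j. cmod (z j)) {..<n} \<le> 1"
      using r by (intro exI[of _ "\<lambda>j. x j / of_real r"]) (simp add: scale, simp add: r_def)
  qed
  moreover have "(\<Sum>j<n. A i j * (x j / of_real r)) = (\<Sum>j<n. A i j * x j) / of_real r" for i
    by (simp add: sum_divide_distrib)
  ultimately have "?L / r \<le> op_norm n A"
    by (simp add: scale)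
  then show ?thesis
    using r by (simp add: field_simps r_def)
qed

text \<open>
  The transpose has the same norm: with $y = A^T x$ one has $\|y\|^2 = \sum_i x_i (A \bar y)_i
  \le \|x\| \|A\| \|y\|$.
\<close>

lemma op_norm_bound_transpose:
  "L2_set (\<lambda>j. cmod (\<Sum>i<n. A i j * x i)) {..<n} \<le> op_norm n A * L2_set (\<lambda>i. cmod (x i)) {..<n}"
proof -
  define y where "y j = (\<Sum>i<n. A i j * x i)" for j
  define Y where "Y = L2_set (\<lambda>j. cmod (y j)) {..<n}"
  define X where "X = L2_set (\<lambda>i. cmod (x i)) {..<n}"
  have "complex_of_real (Y\<^sup>2) = (\<Sum>j<n. y j * cnj (y j))"
    by (simp add: Y_def L2_set_def sum_nonneg complex_norm_square[symmetric] del: of_real_power)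
  also have "\<dots> = (\<Sum>j<n. \<Sum>i<n. x i * (A i j * cnj (y j)))"
    by (simp add: y_def sum_distrib_left sum_distrib_right mult_ac del: cnj_sum)
  also have "\<dots> = (\<Sum>i<n. \<Sum>j<n. x i * (A i j * cnj (y j)))"
    by (rule sum.swap)
  also have "\<dots> = (\<Sum>i<n. x i * (\<Sum>j<n. A i j * cnj (y j)))"
    by (simp add: sum_distrib_left)
  finally have "Y\<^sup>2 = cmod (\<Sum>i<n. x i * (\<Sum>j<n. A i j * cnj (y j)))"
    by (metis abs_of_nonneg norm_of_real zero_le_power2)
  also have "\<dots> \<le> (\<Sum>i<n. \<bar>cmod (x i)\<bar> * \<bar>cmod (\<Sum>j<n. A i j * cnj (y j))\<bar>)"
    by (rule order_trans[OF norm_sum]) (simp add: norm_mult)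
  also have "\<dots> \<le> X * L2_set (\<lambda>i. cmod (\<Sum>j<n. A i j * cnj (y j))) {..<n}"
    unfolding X_def by (rule L2_set_mult_ineq)
  also have "\<dots> \<le> X * (op_norm n A * Y)"
    using op_norm_bound[where n = n and A = A and x = "\<lambda>j. cnj (y j)"]
    by (intro mult_left_mono) (auto simp: X_def Y_def L2_set_nonneg)
  finally have "Y * Y \<le> (op_norm n A * X) * Y"
    by (simp add: power2_eq_square mult_ac)
  moreover have "0 \<le> Y" "0 \<le> X" by (auto simp: X_def Y_def L2_set_nonneg)
  ultimately have "Y \<le> op_norm n A * X"
    using op_norm_nonneg[of n A] by (cases "Y = 0") auto
  then show ?thesis by (simp add: X_def Y_def y_def)
qed


lemma op_norm_bound_sq:
  "(\<Sum>i<n. (cmod (\<Sum>j<n. A i j * x j))\<^sup>2) \<le> (op_norm n A)\<^sup>2 * (\<Sum>j<n. (cmod (x j))\<^sup>2)"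
  using power_mono[OF op_norm_bound[of A x n], of 2]
  by (simp add: L2_set_nonneg power_mult_distrib) (simp add: L2_set_def sum_nonneg)

lemma op_norm_bound_transpose_sq:
  "(\<Sum>j<n. (cmod (\<Sum>i<n. A i j * x i))\<^sup>2) \<le> (op_norm n A)\<^sup>2 * (\<Sum>i<n. (cmod (x i))\<^sup>2)"
  using power_mono[OF op_norm_bound_transpose[of A x n], of 2]
  by (simp add: L2_set_nonneg power_mult_distrib) (simp add: L2_set_def sum_nonneg)

lemma op_norm_zero_entry:
  assumes "op_norm n A = 0" "i < n" "j < n"
  shows "A i j = 0"
proof -
  let ?x = "\<lambda>k. if k = j then 1 else (0 :: complex)"
  have "cmod (\<Sum>k<n. A i k * ?x k) \<le> L2_set (\<lambda>i. cmod (\<Sum>k<n. A i k * ?x k)) {..<n}"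
    using assms by (intro member_le_L2_set) auto
  also have "\<dots> \<le> op_norm n A * L2_set (\<lambda>j. cmod (?x j)) {..<n}" by (rule op_norm_bound)
  finally have "(\<Sum>k<n. A i k * ?x k) = 0" using assms(1) by simp
  moreover have "(\<Sum>k<n. A i k * ?x k) = (\<Sum>k<n. if k = j then A i k else 0)"
    by (intro sum.cong) auto
  ultimately show ?thesis using assms by simp
qed

section \<open>Functionals\<close>

text \<open>
  The points where two linear extensions agree form a subspace containing \<open>C\<close>. This is what gives
  the definite description in \<open>ext\<close> its meaning.
\<close>

lemma extends_to_unique:
  assumes X: "cvs.subspace X" "C \<subseteq> X" "X \<subseteq> cvs.span C"
    and f: "extends_to X C a f" and g: "extends_to X C a g"
  shows "f = g"
proof
  fix x
  show "f x = g x"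
  proof (cases "x \<in> X")
    case True
    then have "x \<in> cvs.span C" using X by auto
    then have "x \<in> X \<and> f x = g x"
    proof (rule cvs.span_induct)
      have "f 0 = 0" "g 0 = 0"
        using f g cvs.subspace_0[OF X(1)] unfolding extends_to_def
        by (metis cvs.scale_zero_left mult_zero_left)+
      then show "cvs.subspace {x. x \<in> X \<and> f x = g x}"
        using f g X(1) unfolding extends_to_def cvs.subspace_def by auto
    next
      fix x assume "x \<in> C"
      then show "x \<in> X \<and> f x = g x" using X f g by (auto simp: extends_to_def)
    qed
    then show ?thesis by simp
  next
    case False
    then show ?thesis using f g by (simp add: extends_to_def)
  qed
qed

lemma ext_eqI:
  assumes "cvs.subspace X" "C \<subseteq> X" "X \<subseteq> cvs.span C" "extends_to X C a f"
  shows "ext X C a = f"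
  unfolding ext_def using assms by (intro the_equality) (auto intro: extends_to_unique)

lemma subspace_mats: "cvs.subspace (mats m n (UNIV :: 'a::complex_vector set))"
  by (auto simp: cvs.subspace_def mats_def scaleC_fun_apply)

locale L1_system =
  fixes K :: "nat \<Rightarrow> 'v::star_locally_convex mtx set"
  assumes mc: "L1_matrix_convex K"
    and span1: "cvs.span (pos_mats K 1) = mats 1 1 UNIV"
begin

lemma K_compact: "1 \<le> n \<Longrightarrow> compact (K n)"
  and K_convex: "1 \<le> n \<Longrightarrow> convex (K n)"
  and K_zero: "1 \<le> n \<Longrightarrow> 0 \<in> K n"
  using mc by (auto simp: L1_matrix_convex_def extreme_point_of_def)

lemma K_mats: "1 \<le> n \<Longrightarrow> u \<in> K n \<Longrightarrow> u \<in> mats n n UNIV"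
  and K_adj: "1 \<le> n \<Longrightarrow> u \<in> K n \<Longrightarrow> adj star u = u"
  using mc by (auto simp: L1_matrix_convex_def sa_mats_def)

lemma K_star: "1 \<le> n \<Longrightarrow> u \<in> K n \<Longrightarrow> star (u i j) = u j i"
  using K_adj[of n u] by (metis adj_def)

lemma K_out: "1 \<le> n \<Longrightarrow> u \<in> K n \<Longrightarrow> \<not> (i < n \<and> j < n) \<Longrightarrow> u i j = 0"
  using K_mats[of n u] unfolding mats_def by blast

text \<open>
  The first condition for a single $\gamma$, with the matrix inequality $\gamma \gamma^* \le I$ in the form in
  which it is verified below.
\<close>

lemma compress:
  assumes n: "1 \<le> n" and p: "1 \<le> p" and u: "u \<in> K n" and \<gamma>: "\<gamma> \<in> mats n p UNIV"
    and le: "\<And>x. (\<Sum>k<p. (cmod (\<Sum>i<n. cnj (\<gamma> i k) * x i))\<^sup>2) \<le> (\<Sum>i<n. (cmod (x i))\<^sup>2)"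
  shows "sandwich n (adj cnj \<gamma>) u \<gamma> \<in> K p"
proof -
  have L1: "L1_cond K" using mc by (simp add: L1_matrix_convex_def)
  have "sandwich n (adj cnj \<gamma>) u \<gamma> i j = 0" if "\<not> (i < p \<and> j < p)" for i j
    using \<gamma> that unfolding sandwich_def adj_def mats_def
    by (intro sum.neutral ballI) auto
  then have "dsum p (sandwich n (adj cnj \<gamma>) u \<gamma>) (\<lambda>i j. 0) = sandwich n (adj cnj \<gamma>) u \<gamma>"
    by (auto simp: dsum_def block_def fun_eq_iff)
  moreover have "psd n (id_mat n - mat_prod p \<gamma> (adj cnj \<gamma>))"
    using le by (rule psd_id_minus)
  ultimately show ?thesis
    using L1[unfolded L1_cond_def, rule_format, OF n u, of "[(p, \<gamma>)]"] p \<gamma> by simp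
qed

text \<open>
  The case where column $k$ of $\gamma$ has the single entry \<open>c k\<close>, in row \<open>\<sigma> k\<close>. Then $\gamma \gamma^*$ is
  diagonal, and contractivity is the bound on the sums of $|c_k|^2$ over the fibres of \<open>\<sigma>\<close>.
\<close>

lemma compress_monomial:
  assumes n: "1 \<le> n" and p: "1 \<le> p" and u: "u \<in> K n" and \<sigma>: "\<And>k. k < p \<Longrightarrow> \<sigma> k < n"
    and le: "\<And>i. i < n \<Longrightarrow> (\<Sum>k<p. if \<sigma> k = i then (cmod (c k))\<^sup>2 else 0) \<le> 1"
  shows "(\<lambda>k l. if k < p \<and> l < p then (cnj (c k) * c l) *\<^sub>C u (\<sigma> k) (\<sigma> l) else 0) \<in> K p"
proof -
  define \<gamma> where "\<gamma> i k = (if k < p \<and> \<sigma> k = i then c k else 0)" for i k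
  have \<gamma>: "\<gamma> \<in> mats n p UNIV" using \<sigma> by (auto simp: \<gamma>_def mats_def)
  have "sandwich n (adj cnj \<gamma>) u \<gamma> \<in> K p"
  proof (rule compress[OF n p u \<gamma>])
    fix x :: "nat \<Rightarrow> complex"
    have "(\<Sum>k<p. (cmod (\<Sum>i<n. cnj (\<gamma> i k) * x i))\<^sup>2) = (\<Sum>k<p. (cmod (c k) * cmod (x (\<sigma> k)))\<^sup>2)"
    proof (intro sum.cong refl)
      fix k assume k: "k \<in> {..<p}"
      have "(\<Sum>i<n. cnj (\<gamma> i k) * x i) = (\<Sum>i<n. if \<sigma> k = i then cnj (c k) * x i else 0)"
        using k by (intro sum.cong) (auto simp: \<gamma>_def)
      then show "(cmod (\<Sum>i<n. cnj (\<gamma> i k) * x i))\<^sup>2 = (cmod (c k) * cmod (x (\<sigma> k)))\<^sup>2"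
        using \<sigma> k by (simp add: norm_mult)
    qed
    also have "\<dots> = (\<Sum>k<p. \<Sum>i<n. if \<sigma> k = i then (cmod (c k) * cmod (x i))\<^sup>2 else 0)"
      using \<sigma> by (intro sum.cong) auto
    also have "\<dots> = (\<Sum>i<n. \<Sum>k<p. if \<sigma> k = i then (cmod (c k) * cmod (x i))\<^sup>2 else 0)"
      by (rule sum.swap)
    also have "\<dots> = (\<Sum>i<n. (\<Sum>k<p. if \<sigma> k = i then (cmod (c k))\<^sup>2 else 0) * (cmod (x i))\<^sup>2)"
      by (intro sum.cong refl) (auto simp: sum_distrib_right power_mult_distrib intro!: sum.cong)
    also have "\<dots> \<le> (\<Sum>i<n. 1 * (cmod (x i))\<^sup>2)"
      using le by (intro sum_mono mult_right_mono) auto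
    finally show "(\<Sum>k<p. (cmod (\<Sum>i<n. cnj (\<gamma> i k) * x i))\<^sup>2) \<le> (\<Sum>i<n. (cmod (x i))\<^sup>2)" by simp
  qed
  also have "sandwich n (adj cnj \<gamma>) u \<gamma> =
      (\<lambda>k l. if k < p \<and> l < p then (cnj (c k) * c l) *\<^sub>C u (\<sigma> k) (\<sigma> l) else 0)"
  proof (intro ext)
    fix k l
    show "sandwich n (adj cnj \<gamma>) u \<gamma> k l
        = (if k < p \<and> l < p then (cnj (c k) * c l) *\<^sub>C u (\<sigma> k) (\<sigma> l) else 0)"
    proof (cases "k < p \<and> l < p")
      case True
      have "sandwich n (adj cnj \<gamma>) u \<gamma> k l
          = (\<Sum>i<n. \<Sum>j<n. if \<sigma> l = j then (if \<sigma> k = i then (cnj (c k) * c l) *\<^sub>C u i j else 0) else 0)"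
        unfolding sandwich_def adj_def using True by (intro sum.cong refl) (auto simp: \<gamma>_def)
      also have "\<dots> = (cnj (c k) * c l) *\<^sub>C u (\<sigma> k) (\<sigma> l)"
        using \<sigma> True by simp
      finally show ?thesis using True by simp
    next
      case False
      then have "sandwich n (adj cnj \<gamma>) u \<gamma> k l = 0"
        unfolding sandwich_def by (intro sum.neutral ballI) (auto simp: \<gamma>_def adj_def)
      then show ?thesis using False by auto
    qed
  qed
  finally show ?thesis .
qed

text \<open>
  Block permutations, phases, restriction to a set of indices and padding by zeros (\<open>c k = 0\<close> off
  the support) are all of this form.
\<close>

lemma compress_inj:
  assumes "1 \<le> n" "1 \<le> p" "u \<in> K n" "\<And>k. k < p \<Longrightarrow> \<sigma> k < n"
    and c: "\<And>k. k < p \<Longrightarrow> cmod (c k) \<le> 1" and inj: "inj_on \<sigma> {k. k < p \<and> c k \<noteq> 0}"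
  shows "(\<lambda>k l. if k < p \<and> l < p then (cnj (c k) * c l) *\<^sub>C u (\<sigma> k) (\<sigma> l) else 0) \<in> K p"
proof (rule compress_monomial)
  fix i
  show "(\<Sum>k<p. if \<sigma> k = i then (cmod (c k))\<^sup>2 else 0) \<le> 1"
  proof (cases "\<exists>k0<p. c k0 \<noteq> 0 \<and> \<sigma> k0 = i")
    case True
    then obtain k0 where k0: "k0 < p" "c k0 \<noteq> 0" "\<sigma> k0 = i" by auto
    have "(\<Sum>k<p. if \<sigma> k = i then (cmod (c k))\<^sup>2 else 0) = (\<Sum>k<p. if k = k0 then (cmod (c k))\<^sup>2 else 0)"
      using k0 inj by (intro sum.cong) (auto simp: inj_on_def)
    also have "\<dots> \<le> 1" using k0 c[of k0] by (simp add: power_le_one)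
    finally show ?thesis .
  next
    case False
    then have "(\<Sum>k<p. if \<sigma> k = i then (cmod (c k))\<^sup>2 else 0) = 0"
      by (intro sum.neutral) auto
    then show ?thesis by simp
  qed
qed (use assms in auto)

lemma row_in_K:
  assumes "1 \<le> n" "w \<in> K 1" "(\<Sum>k<n. (cmod (c k))\<^sup>2) \<le> 1"
  shows "(\<lambda>k l. if k < n \<and> l < n then (cnj (c k) * c l) *\<^sub>C w 0 0 else 0) \<in> K n"
  using compress_monomial[of 1 n w "\<lambda>_. 0" c] assms by simp

lemma span_base: "cvs.span (base K) = UNIV"
proof -
  have "v \<in> cvs.span (base K)" for v
  proof -
    have "m 0 0 \<in> cvs.span (base K)" if "m \<in> cvs.span (pos_mats K 1)" for m
      using that
    proof (rule cvs.span_induct)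
      show "cvs.subspace {m. m 0 0 \<in> cvs.span (base K)}"
        by (auto simp: cvs.subspace_def scaleC_fun_apply cvs.span_zero cvs.span_add cvs.span_scale)
    next
      fix m assume "m \<in> pos_mats K 1"
      then show "m 0 0 \<in> cvs.span (base K)"
        by (auto simp: pos_mats_def base_def scaleR_fun_apply scaleC_fun_apply scaleR_scaleC
            intro!: cvs.span_scale[OF cvs.span_base])
    qed
    from this[of "\<lambda>i j. if i = 0 \<and> j = 0 then v else 0"] show ?thesis
      unfolding span1 by (simp add: mats_def)
  qed
  then show ?thesis by auto
qed

text \<open>
  For $w \in K_1$ and a row vector $c$ of norm at most 1, the matrix $(\bar c_k c_l w)$ lies in \<open>K n\<close>.
  Polarization in $c$ produces every matrix with the single nonzero entry $w$, and \<open>K 1\<close> spans the space.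
\<close>

lemma span_K:
  assumes n: "1 \<le> n"
  shows "mats n n UNIV \<subseteq> cvs.span (K n)"
proof
  define E where "E i j v = (\<lambda>k l. if k = i \<and> l = j then v else 0)" for i j :: nat and v :: 'v
  have E_lin: "E i j (v + w) = E i j v + E i j w" "E i j (c *\<^sub>C v) = c *\<^sub>C E i j v" "E i j 0 = 0" for i j v w c
    by (auto simp: E_def fun_eq_iff scaleC_fun_apply)
  have E_K: "E i j (w 0 0) \<in> cvs.span (K n)" if "i < n" "j < n" "w \<in> K 1" for i j w
  proof (cases "i = j")
    case True
    have "E i i (w 0 0) = (\<lambda>k l. if k < n \<and> l < n then (cnj (if k = i then 1 else 0) * (if l = i then 1 else 0)) *\<^sub>C w 0 0 else 0)"
      using that by (auto simp: E_def fun_eq_iff)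
    also have "\<dots> \<in> K n"
    proof (rule row_in_K[OF n \<open>w \<in> K 1\<close>])
      have "(\<Sum>k<n. (cmod (if k = i then 1 else 0))\<^sup>2) = (\<Sum>k<n. if k = i then 1 else 0)"
        by (intro sum.cong) auto
      then show "(\<Sum>k<n. (cmod (if k = i then 1 else 0))\<^sup>2) \<le> 1" by simp
    qed
    finally show ?thesis using True by (auto intro: cvs.span_base)
  next
    case False
    define F where "F d = (\<lambda>k l. if k < n \<and> l < n then
        (cnj (if k = i then 1/2 else if k = j then d/2 else 0) * (if l = i then 1/2 else if l = j then d/2 else 0)) *\<^sub>C w 0 0 else 0)" for d
    have F: "F d \<in> cvs.span (K n)" if d: "cmod d = 1" for d
    proof -
      have "F d \<in> K n"
        unfolding F_def
      proof (rule row_in_K[OF n \<open>w \<in> K 1\<close>])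
        have "(\<Sum>k<n. (cmod (if k = i then 1/2 else if k = j then d/2 else 0))\<^sup>2)
            = (\<Sum>k<n. (if k = i then 1/4 else 0) + (if k = j then 1/4 else 0))"
          using d False by (intro sum.cong) (auto simp: norm_divide power2_eq_square)
        also have "\<dots> \<le> 1" using that \<open>i < n\<close> \<open>j < n\<close> by (simp add: sum.distrib)
        finally show "(\<Sum>k<n. (cmod (if k = i then 1/2 else if k = j then d/2 else 0))\<^sup>2) \<le> 1" .
      qed
      then show ?thesis by (rule cvs.span_base)
    qed
    \<comment> \<open>polarization: for $|d| = 1$, $F_d$ has entry $d w/4$ at \<open>(i, j)\<close> and $\bar d w/4$ at \<open>(j, i)\<close>, while its diagonal does not depend on $d$\<close>
    have "E i j (w 0 0) = F 1 + (- 1) *\<^sub>C F (- 1) + (- \<i>) *\<^sub>C (F \<i> + (- 1) *\<^sub>C F (- \<i>))"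
      using that False
      by (auto simp: E_def F_def fun_eq_iff scaleC_fun_apply scaleC_scaleC scaleC_add_right
          cvs.scale_right_diff_distrib
          simp flip: scaleC_add_left cvs.scale_minus_left cvs.scale_left_diff_distrib)
    also have "\<dots> \<in> cvs.span (K n)"
      by (intro cvs.span_add cvs.span_scale F) auto
    finally show ?thesis .
  qed
  have E_span: "E i j v \<in> cvs.span (K n)" if "i < n" "j < n" for i j v
  proof -
    have "v \<in> cvs.span (base K)" by (simp add: span_base)
    then show ?thesis
    proof (rule cvs.span_induct)
      show "cvs.subspace {v. E i j v \<in> cvs.span (K n)}"
        by (auto simp: cvs.subspace_def E_lin cvs.span_zero cvs.span_add cvs.span_scale)
    qed (use that E_K in \<open>auto simp: base_def\<close>)
  qed
  fix v :: "'v mtx" assume v: "v \<in> mats n n UNIV"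
  have "v = (\<Sum>i<n. \<Sum>j<n. E i j (v i j))"
  proof (intro ext)
    fix k l
    have "(\<Sum>i<n. \<Sum>j<n. E i j (v i j)) k l = (\<Sum>i<n. if k = i then \<Sum>j<n. if l = j then v i j else 0 else 0)"
      unfolding sum_fun_apply by (intro sum.cong refl) (auto simp: E_def)
    also have "\<dots> = v k l" using v by (auto simp: mats_def)
    finally show "v k l = (\<Sum>i<n. \<Sum>j<n. E i j (v i j)) k l" by simp
  qed
  also have "\<dots> \<in> cvs.span (K n)"
    by (intro cvs.span_sum E_span) auto
  finally show "v \<in> cvs.span (K n)" .
qed

section \<open>Extensions and the pairing\<close>

abbreviation W :: "('v \<Rightarrow> complex) set" where "W \<equiv> A0_V K"

text \<open>Thus \<open>e a\<close> is the linear extension $\tilde a$.\<close>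

abbreviation e :: "('v \<Rightarrow> complex) \<Rightarrow> 'v \<Rightarrow> complex" where "e \<equiv> ext UNIV (base K)"

lemma base_star: "v \<in> base K \<Longrightarrow> star v = v"
  using K_star[of 1] by (auto simp: base_def)

lemma ext_base_eqI: "extends_to UNIV (base K) a f \<Longrightarrow> e a = f"
  by (rule ext_eqI) (auto simp: span_base)

text \<open>
  Continuity on the base, affinity and vanishing at 0 are inherited from the linear extension, so
  only the existence of the extension has to be checked for membership.
\<close>

lemma A0_V_iff:
  "a \<in> W \<longleftrightarrow> (\<forall>x. x \<notin> base K \<longrightarrow> a x = 0) \<and> (\<exists>f. extends_to UNIV (base K) a f)" (is "_ \<longleftrightarrow> ?R")
proof
  assume ?R
  then obtain f where vanish: "\<forall>x. x \<notin> base K \<longrightarrow> a x = 0" and f: "extends_to UNIV (base K) a f"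
    by auto
  from f have add: "f (x + y) = f x + f y" and scale: "f (c *\<^sub>C x) = c * f x"
    and cont: "continuous_on UNIV f" and eq: "x \<in> base K \<Longrightarrow> f x = a x" for x y c
    by (auto simp: extends_to_def)
  have "continuous_on (base K) a"
    using continuous_on_subset[OF cont, of "base K"] eq by (simp cong: continuous_on_cong)
  moreover have "a ((1 - t) *\<^sub>R x + t *\<^sub>R y) = of_real (1 - t) * a x + of_real t * a y"
    if "x \<in> base K" "y \<in> base K" "t \<in> {0..1}" for x y t
  proof -
    from that obtain u v where uv: "u \<in> K 1" "v \<in> K 1" "x = u 0 0" "y = v 0 0"
      by (auto simp: base_def)
    then have "(1 - t) *\<^sub>R u + t *\<^sub>R v \<in> K 1"
      using that K_convex[of 1] by (auto simp: convex_alt)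
    then have "(1 - t) *\<^sub>R x + t *\<^sub>R y \<in> base K"
      unfolding base_def using uv by (intro image_eqI) (auto simp: scaleR_fun_apply)
    then have "a ((1 - t) *\<^sub>R x + t *\<^sub>R y) = f (of_real (1 - t) *\<^sub>C x + of_real t *\<^sub>C y)"
      using eq by (simp only: scaleR_scaleC)
    then show ?thesis using that by (simp only: add scale eq)
  qed
  moreover have "a 0 = 0"
    using vanish eq[of 0] scale[of 0 0] by (cases "0 \<in> base K") auto
  ultimately show "a \<in> W"
    unfolding A0_V_def A0_def using vanish f by blast
qed (auto simp: A0_V_def A0_def)

lemma ext_extends: "a \<in> W \<Longrightarrow> extends_to UNIV (base K) a (e a)"
  using A0_V_iff ext_base_eqI by metis

lemma ext_add_right: "a \<in> W \<Longrightarrow> e a (x + y) = e a x + e a y"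
  and ext_scale_right: "a \<in> W \<Longrightarrow> e a (c *\<^sub>C x) = c * e a x"
  and ext_cont: "a \<in> W \<Longrightarrow> continuous_on UNIV (e a)"
  and ext_base: "a \<in> W \<Longrightarrow> x \<in> base K \<Longrightarrow> e a x = a x"
  using ext_extends[of a] by (auto simp: extends_to_def)

lemma ext_zero_right: "a \<in> W \<Longrightarrow> e a 0 = 0"
  using ext_scale_right[of a 0 0] by simp

lemma ext_sum_right: "a \<in> W \<Longrightarrow> e a (\<Sum>i\<in>I. f i) = (\<Sum>i\<in>I. e a (f i))"
  by (induction I rule: infinite_finite_induct) (auto simp: ext_zero_right ext_add_right)

lemma A0_V_eqI:
  assumes "\<And>x. x \<notin> base K \<Longrightarrow> a x = 0" "extends_to UNIV (base K) a f"
  shows "a \<in> W \<and> e a = f"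
  using assms ext_base_eqI A0_V_iff by blast

lemma A0_V_off: "a \<in> W \<Longrightarrow> x \<notin> base K \<Longrightarrow> a x = 0"
  using A0_V_iff by blast

lemma A0_V_add: assumes "a \<in> W" "b \<in> W" shows "a + b \<in> W \<and> e (a + b) = (\<lambda>v. e a v + e b v)"
  using assms
  by (intro A0_V_eqI)
    (auto simp: extends_to_def A0_V_off ext_add_right ext_scale_right ext_base algebra_simps
      intro!: continuous_intros ext_cont)

lemma A0_V_scale: assumes "a \<in> W" shows "c *\<^sub>C a \<in> W \<and> e (c *\<^sub>C a) = (\<lambda>v. c * e a v)"
  using assms
  by (intro A0_V_eqI)
    (auto simp: extends_to_def A0_V_off ext_add_right ext_scale_right ext_base algebra_simps
      scaleC_fun_apply scaleC_complex_def intro!: continuous_intros ext_cont)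

lemma A0_V_star:
  assumes "a \<in> W" shows "fun_star a \<in> W \<and> e (fun_star a) = (\<lambda>v. cnj (e a (star v)))"
  using assms
  by (intro A0_V_eqI)
    (auto simp: extends_to_def fun_star_def A0_V_off ext_add_right ext_scale_right ext_base
      star_add star_scaleC base_star
      intro!: continuous_intros continuous_on_compose2[OF ext_cont continuous_on_star])

lemma subspace_A0_V: "cvs.subspace W"
proof -
  have "(0 :: 'v \<Rightarrow> complex) \<in> W"
    using A0_V_eqI[of 0 "\<lambda>_. 0"] by (auto simp: extends_to_def)
  then show ?thesis by (auto simp: cvs.subspace_def A0_V_add A0_V_scale)
qed

lemma A0_V_zeroI:
  assumes "a \<in> W" "\<And>v. v \<in> base K \<Longrightarrow> e a v = 0"
  shows "a = 0"
proof
  fix v show "a v = 0 v"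
    using assms ext_base[of a v] A0_V_off[of a v] by (cases "v \<in> base K") auto
qed

lemma mats_W_sub: "a \<in> mats n n W \<Longrightarrow> a i j \<in> W"
  using cvs.subspace_0[OF subspace_A0_V] by (cases "i < n \<and> j < n") (auto simp: mats_def)

lemma mats_W_add: "a \<in> mats n n W \<Longrightarrow> b \<in> mats n n W \<Longrightarrow> a + b \<in> mats n n W"
  by (auto simp: mats_def A0_V_add)

lemma mats_W_scale: "a \<in> mats n n W \<Longrightarrow> c *\<^sub>C a \<in> mats n n W"
  by (auto simp: mats_def A0_V_scale scaleC_fun_apply)

lemma mats_W_diff: "a \<in> mats n n W \<Longrightarrow> b \<in> mats n n W \<Longrightarrow> a - b \<in> mats n n W"
  using mats_W_add[OF _ mats_W_scale, of a n b "- 1"] by (simp add: cvs.scale_minus_left scaleC_one)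

lemma mats_W_adj: "a \<in> mats n n W \<Longrightarrow> adj fun_star a \<in> mats n n W"
  by (auto simp: mats_def adj_def A0_V_star) (auto simp: fun_star_def)

lemma pairing_add_left:
  "a \<in> mats n n W \<Longrightarrow> b \<in> mats n n W \<Longrightarrow> pairing K n (a + b) v = pairing K n a v + pairing K n b v"
  by (simp add: pairing_def sum.distrib A0_V_add mats_W_sub)

lemma pairing_scale_left:
  "a \<in> mats n n W \<Longrightarrow> pairing K n (c *\<^sub>C a) v = c * pairing K n a v"
  by (simp add: pairing_def A0_V_scale mats_W_sub scaleC_fun_apply sum_distrib_left)

lemma pairing_diff_left:
  "a \<in> mats n n W \<Longrightarrow> b \<in> mats n n W \<Longrightarrow> pairing K n (a - b) v = pairing K n a v - pairing K n b v"
  using pairing_add_left[OF mats_W_diff, of a n b b v] by simp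

lemma pairing_adj:
  assumes "a \<in> mats n n W"
  shows "pairing K n (adj fun_star a) v = cnj (pairing K n a (adj star v))"
proof -
  have "pairing K n (adj fun_star a) v = (\<Sum>i<n. \<Sum>j<n. cnj (e (a j i) (star (v i j))))"
    using assms by (simp add: pairing_def adj_def A0_V_star mats_W_sub)
  also have "\<dots> = (\<Sum>j<n. \<Sum>i<n. cnj (e (a j i) (star (v i j))))"
    by (rule sum.swap)
  finally show ?thesis by (simp add: pairing_def adj_def)
qed

lemma pairing_add_right: "a \<in> mats n n W \<Longrightarrow> pairing K n a (v + w) = pairing K n a v + pairing K n a w"
  by (simp add: pairing_def sum.distrib ext_add_right mats_W_sub)

lemma pairing_scale_right: "a \<in> mats n n W \<Longrightarrow> pairing K n a (c *\<^sub>C v) = c * pairing K n a v"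
  by (simp add: pairing_def ext_scale_right mats_W_sub scaleC_fun_apply sum_distrib_left)

lemma pairing_zero_right: "a \<in> mats n n W \<Longrightarrow> pairing K n a 0 = 0"
  by (simp add: pairing_def ext_zero_right mats_W_sub)

lemma pairing_cong: "(\<And>i j. i < n \<Longrightarrow> j < n \<Longrightarrow> v i j = w i j) \<Longrightarrow> pairing K n a v = pairing K n a w"
  by (simp add: pairing_def)

lemma pairing_continuous:
  assumes "a \<in> mats n n W" "\<And>i j. i < n \<Longrightarrow> j < n \<Longrightarrow> continuous_on S (\<lambda>u. g u i j)"
  shows "continuous_on S (\<lambda>u. pairing K n a (g u))"
  unfolding pairing_def
  using assms
  by (intro continuous_on_sum continuous_on_compose2[OF ext_cont]) (auto simp: mats_W_sub)

lemma continuous_on_entry: "continuous_on S (\<lambda>u. u i j :: 'b::topological_space)"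
  by (rule continuous_on_product_then_coordinatewise[of S "\<lambda>u. u i",
        OF continuous_on_product_then_coordinatewise[of S "\<lambda>u. u", OF continuous_on_id]])

text \<open>
  The pairing is a continuous linear functional on all matrices that agrees with \<open>Phi K n a\<close> on \<open>K n\<close>,
  hence it is the extension.
\<close>

lemma ext_Phi:
  assumes n: "1 \<le> n" and a: "a \<in> mats n n W" and v: "v \<in> mats n n UNIV"
  shows "ext (mats n n UNIV) (K n) (Phi K n a) v = pairing K n a v"
proof -
  let ?f = "\<lambda>v. if v \<in> mats n n UNIV then pairing K n a v else 0"
  have "ext (mats n n UNIV) (K n) (Phi K n a) = ?f"
  proof (rule ext_eqI[OF subspace_mats _ span_K[OF n]])
    show "K n \<subseteq> mats n n UNIV" using K_mats n by auto
    have "continuous_on (mats n n UNIV) (\<lambda>v. pairing K n a v)"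
      using a by (rule pairing_continuous) (rule continuous_on_entry)
    then have "continuous_on (mats n n UNIV) ?f"
      by (simp cong: continuous_on_cong)
    then show "extends_to (mats n n UNIV) (K n) (Phi K n a) ?f"
      using subspace_mats[of n n, where 'a = 'v] a K_mats[OF n]
      by (auto simp: extends_to_def cvs.subspace_def pairing_add_right pairing_scale_right Phi_def)
  qed
  then show ?thesis using v by simp
qed

lemma fun_star_Phi:
  assumes "1 \<le> n" "a \<in> mats n n W"
  shows "fun_star (Phi K n a) = Phi K n (adj fun_star a)"
proof
  fix v
  show "fun_star (Phi K n a) v = Phi K n (adj fun_star a) v"
    by (cases "v \<in> K n") (simp_all add: fun_star_def Phi_def pairing_adj[OF assms(2)] K_adj[OF assms(1)])
qed

section \<open>The norm as a supremum over corners\<close>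

text \<open>
  The blocks of a $2n \times 2n$ matrix, cut off to matrices of size \<open>n\<close>; the remaining block of an
  element of \<open>K (2 * n)\<close> is the adjoint of \<open>corner12\<close>.
\<close>

definition corner12 :: "nat \<Rightarrow> 'v mtx \<Rightarrow> 'v mtx" where
  "corner12 n u = (\<lambda>i j. if i < n \<and> j < n then u i (n + j) else 0)"

definition corner11 :: "nat \<Rightarrow> 'v mtx \<Rightarrow> 'v mtx" where
  "corner11 n u = (\<lambda>i j. if i < n \<and> j < n then u i j else 0)"

definition corner22 :: "nat \<Rightarrow> 'v mtx \<Rightarrow> 'v mtx" where
  "corner22 n u = (\<lambda>i j. if i < n \<and> j < n then u (n + i) (n + j) else 0)"

lemma corner12_mats: "corner12 n u \<in> mats n n UNIV"
  and corner11_mats: "corner11 n u \<in> mats n n UNIV"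
  and corner22_mats: "corner22 n u \<in> mats n n UNIV"
  by (auto simp: corner12_def corner11_def corner22_def mats_def)

lemma block_corners:
  assumes n: "1 \<le> n" and u: "u \<in> K (2 * n)"
  shows "block n (corner11 n u) (corner12 n u) (adj star (corner12 n u)) (corner22 n u) = u"
proof (intro ext)
  fix i j
  have "1 \<le> 2 * n" using n by simp
  note K_out[OF this u] K_star[OF this u]
  moreover have "k - n < n \<longleftrightarrow> k < 2 * n" for k using n by arith
  ultimately show "block n (corner11 n u) (corner12 n u) (adj star (corner12 n u)) (corner22 n u) i j = u i j"
    by (auto simp: block_def corner12_def corner11_def corner22_def adj_def star_zero)
qed

lemma corner12_zero: "corner12 n 0 = 0"
  by (simp add: corner12_def zero_fun_def)

lemma corner12_block: "u12 \<in> mats n n UNIV \<Longrightarrow> corner12 n (block n u11 u12 u21 u22) = u12"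
  by (intro ext) (auto simp: corner12_def block_def mats_def)

lemma A0_norm_eq:
  assumes n: "1 \<le> n" and a: "a \<in> mats n n W"
  shows "A0_norm K n a = (SUP u\<in>K (2 * n). 2 * \<bar>Re (pairing K n a (corner12 n u))\<bar>)"
proof -
  let ?g = "\<lambda>w. cmod (ext (mats n n UNIV) (K n) (Phi K n a) w +
        ext (mats n n UNIV) (K n) (fun_star (Phi K n a)) (adj star w))"
  have g: "?g w = 2 * \<bar>Re (pairing K n a w)\<bar>" if w: "w \<in> mats n n UNIV" for w
  proof -
    have "adj star w \<in> mats n n UNIV" using w by (auto simp: adj_def mats_def star_zero)
    moreover have "adj star (adj star w) = w" by (simp add: adj_def star_star)
    ultimately have "?g w = cmod (pairing K n a w + cnj (pairing K n a w))"
      using n a w mats_W_adj[OF a] by (simp add: ext_Phi fun_star_Phi pairing_adj)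
    then show ?thesis by (simp add: complex_add_cnj norm_mult)
  qed
  have "{?g u12 | u11 u12 u22. u11 \<in> mats n n UNIV \<and> u12 \<in> mats n n UNIV \<and> u22 \<in> mats n n UNIV \<and>
      block n u11 u12 (adj star u12) u22 \<in> K (2 * n)}
     = (\<lambda>u. 2 * \<bar>Re (pairing K n a (corner12 n u))\<bar>) ` K (2 * n)" (is "?A = ?B")
  proof
    show "?A \<subseteq> ?B"
      using g corner12_block by (auto intro!: image_eqI)
    show "?B \<subseteq> ?A"
    proof safe
      fix u assume u: "u \<in> K (2 * n)"
      then show "\<exists>u11 u12 u22. 2 * \<bar>Re (pairing K n a (corner12 n u))\<bar> = ?g u12 \<and>
        u11 \<in> mats n n UNIV \<and> u12 \<in> mats n n UNIV \<and> u22 \<in> mats n n UNIV \<and>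
        block n u11 u12 (adj star u12) u22 \<in> K (2 * n)"
        using block_corners[OF n u] g[OF corner12_mats] corner12_mats corner11_mats corner22_mats by metis
    qed
  qed
  then show ?thesis by (simp add: A0_norm_def inf_norm_def)
qed

text \<open>
  Conjugation by the unitary $\mathrm{diag}(1, d)$.
\<close>

lemma rotate_corner12:
  assumes n: "1 \<le> n" and u: "u \<in> K (2 * n)" and d: "cmod d = 1"
  obtains u' where "u' \<in> K (2 * n)" "corner12 n u' = d *\<^sub>C corner12 n u"
proof
  let ?c = "\<lambda>k. if k < n then 1 else d"
  let ?u = "\<lambda>k l. if k < 2 * n \<and> l < 2 * n then (cnj (?c k) * ?c l) *\<^sub>C u k l else 0"
  show "?u \<in> K (2 * n)"
    by (rule compress_inj[where \<sigma> = "\<lambda>k. k", OF _ _ u]) (use n d in auto)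
  show "corner12 n ?u = d *\<^sub>C corner12 n u"
    by (auto simp: corner12_def fun_eq_iff scaleC_fun_apply)
qed

text \<open>
  The supremum is finite because a continuous function is bounded on the compact \<open>K (2 * n)\<close>;
  rotating the corner turns the real part into the modulus.
\<close>

lemma A0_norm_upper:
  assumes n: "1 \<le> n" and a: "a \<in> mats n n W" and u: "u \<in> K (2 * n)"
  shows "2 * cmod (pairing K n a (corner12 n u)) \<le> A0_norm K n a"
proof -
  let ?f = "\<lambda>u. 2 * \<bar>Re (pairing K n a (corner12 n u))\<bar>"
  have "continuous_on (K (2 * n)) ?f"
    by (intro continuous_intros pairing_continuous a) (simp add: corner12_def continuous_on_entry)
  then have "bdd_above (?f ` K (2 * n))"
    using K_compact[of "2 * n"] n
    by (intro bounded_imp_bdd_above compact_imp_bounded compact_continuous_image) auto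
  then have le: "?f u' \<le> A0_norm K n a" if "u' \<in> K (2 * n)" for u'
    unfolding A0_norm_eq[OF n a] using that by (rule cSUP_upper2) auto
  define z where "z = pairing K n a (corner12 n u)"
  show ?thesis
  proof (cases "z = 0")
    case True
    then show ?thesis using le[OF u] by (simp add: z_def)
  next
    case False
    define d where "d = cnj z / of_real (cmod z)"
    have "cmod d = 1" using False by (simp add: d_def norm_divide)
    then obtain u' where u': "u' \<in> K (2 * n)" "corner12 n u' = d *\<^sub>C corner12 n u"
      using rotate_corner12[OF n u] by blast
    have "d * z = of_real (cmod z)"
      using False complex_norm_square[of z]
      by (simp add: d_def field_simps power2_eq_square)
    then have "pairing K n a (corner12 n u') = of_real (cmod z)"
      using a u' by (simp add: pairing_scale_right z_def)
    then show ?thesis using le[OF u'(1)] by (simp add: z_def)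
  qed
qed

text \<open>
  Rotation by $-1$ removes the absolute value, so that only real parts have to be bounded.
\<close>

lemma A0_norm_least:
  assumes n: "1 \<le> n" and a: "a \<in> mats n n W"
    and le: "\<And>u. u \<in> K (2 * n) \<Longrightarrow> 2 * Re (pairing K n a (corner12 n u)) \<le> B"
  shows "A0_norm K n a \<le> B"
  unfolding A0_norm_eq[OF n a]
proof (rule cSUP_least)
  have "0 \<in> K (2 * n)" using n by (intro K_zero) linarith
  then show "K (2 * n) \<noteq> {}" by blast
next
  fix u assume u: "u \<in> K (2 * n)"
  have "cmod (- 1) = 1" by simp
  then obtain u' where u': "u' \<in> K (2 * n)" "corner12 n u' = (- 1) *\<^sub>C corner12 n u"
    using rotate_corner12[OF n u] by blast
  have "pairing K n a (corner12 n u') = - pairing K n a (corner12 n u)"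
    unfolding u'(2) using pairing_scale_right[OF a, of "-1" "corner12 n u"] by simp
  then show "2 * \<bar>Re (pairing K n a (corner12 n u))\<bar> \<le> B"
    using le[OF u] le[OF u'(1)] by (simp add: abs_if)
qed

text \<open>
  Compressing $u$ by $\gamma = (I, I)/\sqrt 2$ gives an element of \<open>K (2 * n)\<close> all of whose blocks are $u/2$.
\<close>

lemma A0_norm_bound:
  assumes n: "1 \<le> n" and a: "a \<in> mats n n W" and u: "u \<in> K n"
  shows "cmod (pairing K n a u) \<le> A0_norm K n a"
proof -
  define r where "r = complex_of_real (1 / sqrt 2)"
  have r: "cnj r * r = 1 / 2" "(cmod r)\<^sup>2 = 1 / 2"
    by (simp_all add: r_def norm_divide power_divide flip: of_real_mult)
  define \<sigma> where "\<sigma> k = (if k < n then k else k - n)" for k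
  let ?u = "\<lambda>k l. if k < 2 * n \<and> l < 2 * n then (cnj r * r) *\<^sub>C u (\<sigma> k) (\<sigma> l) else 0"
  have "?u \<in> K (2 * n)"
  proof (rule compress_monomial[OF n _ u])
    fix i assume i: "i < n"
    have "(\<Sum>k<2 * n. if \<sigma> k = i then (cmod r)\<^sup>2 else 0)
        = (\<Sum>k<2 * n. (if k = i then 1 / 2 else 0) + (if k = n + i then 1 / 2 else 0))"
      using i by (intro sum.cong) (auto simp: \<sigma>_def r)
    also have "\<dots> \<le> 1" using i by (simp add: sum.distrib)
    finally show "(\<Sum>k<2 * n. if \<sigma> k = i then (cmod r)\<^sup>2 else 0) \<le> 1" .
  qed (use n in \<open>auto simp: \<sigma>_def\<close>)
  from A0_norm_upper[OF n a this] have "2 * cmod (pairing K n a (corner12 n ?u)) \<le> A0_norm K n a" .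
  moreover have "pairing K n a (corner12 n ?u) = pairing K n a ((1 / 2) *\<^sub>C u)"
    by (rule pairing_cong) (simp add: r corner12_def scaleC_fun_apply \<sigma>_def)
  ultimately show ?thesis
    using a by (simp add: pairing_scale_right norm_mult)
qed

section \<open>The norm axioms\<close>

lemma pairing_zero_left: "pairing K n 0 v = 0"
proof -
  have "0 \<in> mats n n W" using cvs.subspace_0[OF subspace_A0_V] by (auto simp: mats_def)
  from pairing_diff_left[OF this this, of v] show ?thesis by simp
qed

lemma A0_norm_nonneg: "1 \<le> n \<Longrightarrow> a \<in> mats n n W \<Longrightarrow> 0 \<le> A0_norm K n a"
  using A0_norm_bound[of n a 0] K_zero[of n] norm_ge_zero order_trans by blast

lemma A0_norm_zero:
  assumes "1 \<le> n" shows "A0_norm K n 0 = 0"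
proof -
  have "(0 :: ('v \<Rightarrow> complex) mtx) \<in> mats n n W" using cvs.subspace_0[OF subspace_A0_V] by (auto simp: mats_def)
  then show ?thesis
    using A0_norm_least[OF assms, of 0 0] A0_norm_nonneg[OF assms, of 0] by (simp add: pairing_zero_left)
qed

text \<open>
  Testing against the row vector with entries $1/2$ at \<open>i\<close> and \<open>n + j\<close> leaves in the corner the single
  entry $w/4$ at \<open>(i, j)\<close>, so vanishing norm forces $\tilde a_{ij}(w) = 0$ for $w \in K_1$.
\<close>

lemma A0_norm_eq_zeroD:
  assumes n: "1 \<le> n" and a: "a \<in> mats n n W" and N: "A0_norm K n a = 0"
  shows "a = 0"
proof (intro ext)
  fix i j
  have "a i j = 0"
  proof (cases "i < n \<and> j < n")
    case True
    show ?thesis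
    proof (rule A0_V_zeroI)
      show "a i j \<in> W" using a by (rule mats_W_sub)
      fix v assume "v \<in> base K"
      then obtain w where w: "w \<in> K 1" "v = w 0 0" by (auto simp: base_def)
      let ?c = "\<lambda>k. if k = i \<or> k = n + j then 1 / 2 else (0 :: complex)"
      let ?u = "\<lambda>k l. if k < 2 * n \<and> l < 2 * n then (cnj (?c k) * ?c l) *\<^sub>C w 0 0 else 0"
      have "(\<Sum>k<2 * n. (cmod (?c k))\<^sup>2) = (\<Sum>k<2 * n. (if k = i then 1 / 4 else 0) + (if k = n + j then 1 / 4 else 0))"
        using True by (intro sum.cong) (auto simp: power2_eq_square)
      also have "\<dots> \<le> 1" using True by (simp add: sum.distrib)
      finally have "?u \<in> K (2 * n)"
        using row_in_K[of "2 * n" w ?c] n w by simp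
      from A0_norm_upper[OF n a this] have "pairing K n a (corner12 n ?u) = 0"
        using N by simp
      moreover have "pairing K n a (corner12 n ?u)
          = (\<Sum>k<n. \<Sum>l<n. if l = j then (if k = i then e (a k l) ((1 / 4) *\<^sub>C v) else 0) else 0)"
        unfolding pairing_def
        by (intro sum.cong refl) (use True w in \<open>auto simp: corner12_def ext_zero_right mats_W_sub[OF a]\<close>)
      ultimately show "e (a i j) v = 0"
        using True by (simp add: ext_scale_right mats_W_sub[OF a])
    qed
  qed (use a in \<open>auto simp: mats_def\<close>)
  then show "a i j x = (0 :: ('v \<Rightarrow> complex) mtx) i j x" for x by simp
qed

lemma A0_norm_scale_le:
  assumes n: "1 \<le> n" and a: "a \<in> mats n n W"
  shows "A0_norm K n (c *\<^sub>C a) \<le> cmod c * A0_norm K n a"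
proof (rule A0_norm_least[OF n mats_W_scale[OF a]])
  fix u assume u: "u \<in> K (2 * n)"
  have "2 * Re (pairing K n (c *\<^sub>C a) (corner12 n u)) \<le> 2 * cmod (c * pairing K n a (corner12 n u))"
    using complex_Re_le_cmod[of "c * pairing K n a (corner12 n u)"] a by (simp add: pairing_scale_left)
  also have "\<dots> = cmod c * (2 * cmod (pairing K n a (corner12 n u)))" by (simp add: norm_mult)
  also have "\<dots> \<le> cmod c * A0_norm K n a"
    by (intro mult_left_mono A0_norm_upper n a u) simp
  finally show "2 * Re (pairing K n (c *\<^sub>C a) (corner12 n u)) \<le> cmod c * A0_norm K n a" .
qed

lemma A0_norm_scale:
  assumes n: "1 \<le> n" and a: "a \<in> mats n n W"
  shows "A0_norm K n (c *\<^sub>C a) = cmod c * A0_norm K n a"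
proof (cases "c = 0")
  case True
  then show ?thesis using n by (simp add: A0_norm_zero)
next
  case False
  have "A0_norm K n a = A0_norm K n (inverse c *\<^sub>C (c *\<^sub>C a))"
    using False by (simp add: scaleC_scaleC scaleC_one)
  also have "\<dots> \<le> cmod (inverse c) * A0_norm K n (c *\<^sub>C a)"
    by (rule A0_norm_scale_le[OF n mats_W_scale[OF a]])
  finally have "cmod c * A0_norm K n a \<le> A0_norm K n (c *\<^sub>C a)"
    using False unfolding norm_inverse by (simp add: field_simps)
  then show ?thesis using A0_norm_scale_le[OF n a, of c] by simp
qed

lemma A0_norm_triangle:
  assumes n: "1 \<le> n" and a: "a \<in> mats n n W" and b: "b \<in> mats n n W"
  shows "A0_norm K n (a + b) \<le> A0_norm K n a + A0_norm K n b"
proof (rule A0_norm_least[OF n mats_W_add[OF a b]])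
  fix u assume u: "u \<in> K (2 * n)"
  show "2 * Re (pairing K n (a + b) (corner12 n u)) \<le> A0_norm K n a + A0_norm K n b"
    using A0_norm_upper[OF n a u] A0_norm_upper[OF n b u] complex_Re_le_cmod[of "pairing K n a (corner12 n u)"]
      complex_Re_le_cmod[of "pairing K n b (corner12 n u)"]
    by (simp add: pairing_add_left[OF a b])
qed

lemma norm_on_A0: "1 \<le> n \<Longrightarrow> norm_on (mats n n W) (A0_norm K n)"
  unfolding norm_on_def
  using A0_norm_nonneg A0_norm_eq_zeroD A0_norm_zero A0_norm_scale A0_norm_triangle by blast

section \<open>The norm of a direct sum\<close>

text \<open>
  By compactness there is a smallest $\alpha$ with \<open>x \<in> \<alpha> *\<^sub>R K n\<close>; the corresponding \<open>w\<close> cannot be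
  shrunk further, which is what being a lead point means.
\<close>

lemma lead_decomposition:
  assumes n: "1 \<le> n" and x: "x \<in> K n" "x \<noteq> 0"
  obtains \<alpha> w where "\<alpha> \<in> {0..1}" "w \<in> lead (K n)" "x = \<alpha> *\<^sub>R w"
proof -
  define S where "S = ({0..1::real} \<times> K n) \<inter> {p. \<forall>i j. x i j = fst p *\<^sub>R snd p i j}"
  have S_iff: "p \<in> S \<longleftrightarrow> fst p \<in> {0..1} \<and> snd p \<in> K n \<and> x = fst p *\<^sub>R snd p" for p
    by (auto simp: S_def mem_Times_iff fun_eq_iff scaleR_fun_apply)
  have "closed {p :: real \<times> 'v mtx. \<forall>i j. x i j = fst p *\<^sub>R snd p i j}"
    unfolding scaleR_scaleC
    by (intro closed_Collect_all closed_Collect_eq continuous_intros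
        continuous_on_compose2[OF continuous_on_entry[of UNIV]]) auto
  then have "compact S"
    unfolding S_def using K_compact[OF n] by (intro compact_Int_closed compact_Times) auto
  then have "compact (fst ` S)"
    by (intro compact_continuous_image continuous_intros)
  moreover have "(1, x) \<in> S" using x by (simp add: S_iff)
  ultimately obtain \<alpha> where \<alpha>: "\<alpha> \<in> fst ` S" "\<And>t. t \<in> fst ` S \<Longrightarrow> \<alpha> \<le> t"
    using compact_attains_inf[of "fst ` S"] by blast
  then obtain w where w: "(\<alpha>, w) \<in> S" by auto
  have "w \<in> lead (K n)"
    unfolding lead_def
  proof (safe)
    show "w \<in> K n" using w by (simp add: S_iff)
    fix \<beta> k assume \<beta>: "\<beta> \<in> {0..1}" and k: "k \<in> K n" "w = \<beta> *\<^sub>R k"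
    have "\<alpha> * \<beta> \<in> {0..1}" using w \<beta> by (auto simp: S_iff mult_le_one)
    then have "(\<alpha> * \<beta>, k) \<in> S" using w k by (simp add: S_iff)
    then have "\<alpha> \<le> \<alpha> * \<beta>" using \<alpha>(2) by force
    moreover have "\<alpha> > 0" using w x by (cases "\<alpha> = 0") (auto simp: S_iff)
    ultimately show "\<beta> = 1" using \<beta> by simp
  qed
  with w that show thesis by (auto simp: S_iff)
qed

lemma A0_norm_upper_scale:
  assumes n: "1 \<le> n" and a: "a \<in> mats n n W" and w: "w \<in> K (2 * n)" and \<alpha>: "0 \<le> \<alpha>"
  shows "2 * cmod (pairing K n a (corner12 n (\<alpha> *\<^sub>R w))) \<le> \<alpha> * A0_norm K n a"
proof -
  have "corner12 n (\<alpha> *\<^sub>R w) = of_real \<alpha> *\<^sub>C corner12 n w"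
    by (auto simp: corner12_def fun_eq_iff scaleR_fun_apply scaleC_fun_apply scaleR_scaleC)
  then show ?thesis
    using mult_left_mono[OF A0_norm_upper[OF n a w] \<alpha>] \<alpha> a by (simp add: pairing_scale_right norm_mult)
qed

lemma sum_lessThan_add:
  "(\<Sum>i<n + m. f i) = (\<Sum>i<n. f i) + (\<Sum>i<m. f (n + i :: nat) :: 'b::comm_monoid_add)"
  by (induction m) (auto simp: add.assoc)

lemma ext_zero_left: "e 0 v = 0"
proof -
  have "0 \<in> W" by (rule cvs.subspace_0[OF subspace_A0_V])
  from A0_V_scale[OF this, of 0] show ?thesis by simp
qed

lemma pairing_dsum:
  "pairing K (n + m) (dsum n a b) v = pairing K n a v + pairing K m b (\<lambda>i j. v (n + i) (n + j))"
  by (simp add: pairing_def sum_lessThan_add dsum_def block_def ext_zero_left)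

lemma dsum_mats: "a \<in> mats n n W \<Longrightarrow> b \<in> mats m m W \<Longrightarrow> dsum n a b \<in> mats (n + m) (n + m) W"
  using cvs.subspace_0[OF subspace_A0_V]
  by (auto simp: mats_def dsum_def block_def less_diff_conv2 not_less add.commute)

text \<open>
  Padding $u \in K_{2n}$ by zero rows and columns in both blocks gives an element of $K_{2(n+m)}$ with
  corner $u_{12} \oplus 0$, and similarly for \<open>b\<close>.
\<close>

lemma A0_norm_dsum_ge:
  assumes n: "1 \<le> n" and m: "1 \<le> m" and a: "a \<in> mats n n W" and b: "b \<in> mats m m W"
  shows "max (A0_norm K n a) (A0_norm K m b) \<le> A0_norm K (n + m) (dsum n a b)"
proof -
  have nm: "1 \<le> n + m" using n by simp
  have "A0_norm K n a \<le> A0_norm K (n + m) (dsum n a b)"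
  proof (rule A0_norm_least[OF n a])
    fix u assume u: "u \<in> K (2 * n)"
    define \<sigma> where "\<sigma> k = (if k < n then k else if n + m \<le> k \<and> k < 2 * n + m then k - m else 0)" for k
    define c :: "nat \<Rightarrow> complex" where "c k = (if k < n \<or> n + m \<le> k \<and> k < 2 * n + m then 1 else 0)" for k
    define u' where "u' = (\<lambda>k l. if k < 2 * (n + m) \<and> l < 2 * (n + m) then (cnj (c k) * c l) *\<^sub>C u (\<sigma> k) (\<sigma> l) else 0)"
    have u': "u' \<in> K (2 * (n + m))"
      unfolding u'_def
      by (rule compress_inj[OF _ _ u]) (use n in \<open>auto simp: \<sigma>_def c_def inj_on_def split: if_splits\<close>)
    have "pairing K (n + m) (dsum n a b) (corner12 (n + m) u') = pairing K n a (corner12 n u) + pairing K m b 0"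
      unfolding pairing_dsum
      by (intro arg_cong2[where f = "(+)"] pairing_cong) (auto simp: corner12_def u'_def c_def \<sigma>_def)
    then show "2 * Re (pairing K n a (corner12 n u)) \<le> A0_norm K (n + m) (dsum n a b)"
      using A0_norm_upper[OF nm dsum_mats[OF a b] u'] complex_Re_le_cmod[of "pairing K n a (corner12 n u)"]
      by (simp add: pairing_zero_right[OF b])
  qed
  moreover have "A0_norm K m b \<le> A0_norm K (n + m) (dsum n a b)"
  proof (rule A0_norm_least[OF m b])
    fix u assume u: "u \<in> K (2 * m)"
    define \<sigma> where "\<sigma> k = (if n \<le> k \<and> k < n + m then k - n else if 2 * n + m \<le> k then k - 2 * n else 0)" for k
    define c :: "nat \<Rightarrow> complex" where "c k = (if n \<le> k \<and> k < n + m \<or> 2 * n + m \<le> k then 1 else 0)" for k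
    define u' where "u' = (\<lambda>k l. if k < 2 * (n + m) \<and> l < 2 * (n + m) then (cnj (c k) * c l) *\<^sub>C u (\<sigma> k) (\<sigma> l) else 0)"
    have u': "u' \<in> K (2 * (n + m))"
      unfolding u'_def
      by (rule compress_inj[OF _ _ u]) (use m in \<open>auto simp: \<sigma>_def c_def inj_on_def split: if_splits\<close>)
    have "pairing K (n + m) (dsum n a b) (corner12 (n + m) u') = pairing K n a 0 + pairing K m b (corner12 m u)"
      unfolding pairing_dsum
      by (intro arg_cong2[where f = "(+)"] pairing_cong) (auto simp: corner12_def u'_def c_def \<sigma>_def)
    then show "2 * Re (pairing K m b (corner12 m u)) \<le> A0_norm K (n + m) (dsum n a b)"
      using A0_norm_upper[OF nm dsum_mats[OF a b] u'] complex_Re_le_cmod[of "pairing K m b (corner12 m u)"]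
      by (simp add: pairing_zero_right[OF a])
  qed
  ultimately show ?thesis by simp
qed

text \<open>
  Here the third condition enters: if $x \oplus y$ lies in $K_{2n+2m}$, then the scaling factors of $x$ and
  $y$ relative to lead points add up to at most 1. Points that are 0 need a separate treatment, since
  \<open>K n\<close> might have no lead point.
\<close>

lemma A0_norm_dsum_le:
  assumes n: "1 \<le> n" and m: "1 \<le> m" and a: "a \<in> mats n n W" and b: "b \<in> mats m m W"
  shows "A0_norm K (n + m) (dsum n a b) \<le> max (A0_norm K n a) (A0_norm K m b)" (is "_ \<le> ?M")
proof (rule A0_norm_least[OF _ dsum_mats[OF a b]])
  show "1 \<le> n + m" using n by simp
  fix u assume u: "u \<in> K (2 * (n + m))"
  \<comment> \<open>the permutation that collects the indices of the two copies of \<open>a\<close> before those of \<open>b\<close>\<close>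
  define \<sigma> where "\<sigma> k = (if k < n then k else if k < 2 * n then k + m else if k < 2 * n + m then k - n else k)" for k
  have inj: "inj \<sigma>" by (auto simp: \<sigma>_def inj_def split: if_splits)
  have lt: "\<sigma> k < 2 * (n + m)" if "k < 2 * (n + m)" for k using that by (auto simp: \<sigma>_def)
  define x where "x = (\<lambda>i j. if i < 2 * n \<and> j < 2 * n then (cnj 1 * 1) *\<^sub>C u (\<sigma> i) (\<sigma> j) else 0)"
  define y where "y = (\<lambda>i j. if i < 2 * m \<and> j < 2 * m then (cnj 1 * 1) *\<^sub>C u (\<sigma> (2 * n + i)) (\<sigma> (2 * n + j)) else 0)"
  have x: "x \<in> K (2 * n)"
    unfolding x_def
    by (rule compress_inj[OF _ _ u]) (use n lt in \<open>auto simp: inj_on_def inj_eq[OF inj]\<close>)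
  have y: "y \<in> K (2 * m)"
    unfolding y_def
    by (rule compress_inj[OF _ _ u]) (use m lt in \<open>auto simp: inj_on_def inj_eq[OF inj]\<close>)
  have xy: "block (2 * n) x 0 (adj star 0) y \<in> K (2 * n + 2 * m)"
  proof -
    \<comment> \<open>pinching: averaging over the signs $\mathrm{diag}(1, \pm 1)$ kills the off-diagonal blocks\<close>
    define s :: "nat \<Rightarrow> complex" where "s k = (if k < 2 * n then 1 else - 1)" for k
    define U where "U t = (\<lambda>k l. if k < 2 * n + 2 * m \<and> l < 2 * n + 2 * m then (cnj (t k) * t l) *\<^sub>C u (\<sigma> k) (\<sigma> l) else 0)" for t
    have U: "U t \<in> K (2 * n + 2 * m)" if "\<And>k. cmod (t k) \<le> 1" for t
      unfolding U_def
      by (rule compress_inj[OF _ _ u]) (use n lt that in \<open>auto simp: inj_on_def inj_eq[OF inj]\<close>)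
    have "(1 / 2) *\<^sub>R U (\<lambda>_. 1) + (1 / 2) *\<^sub>R U s \<in> K (2 * n + 2 * m)"
      by (rule convexD[OF K_convex]) (use n U in \<open>auto simp: s_def\<close>)
    also have "(1 / 2) *\<^sub>R U (\<lambda>_. 1) + (1 / 2) *\<^sub>R U s = block (2 * n) x 0 (adj star 0) y"
    proof (intro ext)
      fix k l
      show "((1 / 2) *\<^sub>R U (\<lambda>_. 1) + (1 / 2) *\<^sub>R U s) k l = block (2 * n) x 0 (adj star 0) y k l"
        by (auto simp: U_def s_def block_def x_def y_def adj_def star_zero scaleR_fun_apply
            scaleC_one simp flip: scaleR_add_left)
    qed
    finally show ?thesis .
  qed
  have split: "pairing K (n + m) (dsum n a b) (corner12 (n + m) u) = pairing K n a (corner12 n x) + pairing K m b (corner12 m y)"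
  proof -
    have \<sigma>_eq: "\<sigma> i = i" "\<sigma> (n + i) = n + m + i" if "i < n" for i
      using that unfolding \<sigma>_def by simp_all
    have "pairing K n a (corner12 (n + m) u) = pairing K n a (corner12 n x)"
    proof (rule pairing_cong)
      fix i j assume ij: "i < n" "j < n"
      then have "corner12 (n + m) u i j = u i (n + m + j)" unfolding corner12_def by simp
      moreover have "corner12 n x i j = u (\<sigma> i) (\<sigma> (n + j))"
        using ij unfolding corner12_def x_def by (simp add: scaleC_one)
      ultimately show "corner12 (n + m) u i j = corner12 n x i j"
        using \<sigma>_eq(1)[OF ij(1)] \<sigma>_eq(2)[OF ij(2)] by metis
    qed
    moreover have "pairing K m b (\<lambda>i j. corner12 (n + m) u (n + i) (n + j)) = pairing K m b (corner12 m y)"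
    proof (rule pairing_cong)
      fix i j assume ij: "i < m" "j < m"
      have \<sigma>_eq: "\<sigma> (2 * n + i) = n + i" "\<sigma> (2 * n + (m + j)) = n + m + (n + j)"
        using ij unfolding \<sigma>_def by simp_all
      have "corner12 (n + m) u (n + i) (n + j) = u (n + i) (n + m + (n + j))"
        using ij unfolding corner12_def by simp
      moreover have "corner12 m y i j = u (\<sigma> (2 * n + i)) (\<sigma> (2 * n + (m + j)))"
        using ij unfolding corner12_def y_def by (simp add: scaleC_one)
      ultimately show "corner12 (n + m) u (n + i) (n + j) = corner12 m y i j"
        unfolding \<sigma>_eq by metis
    qed
    ultimately show ?thesis unfolding pairing_dsum by simp
  qed
  have M: "A0_norm K n a \<le> ?M" "A0_norm K m b \<le> ?M" "0 \<le> ?M"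
    using A0_norm_nonneg[OF n a] by (simp_all add: le_max_iff_disj)
  have "2 * cmod (pairing K n a (corner12 n x)) + 2 * cmod (pairing K m b (corner12 m y)) \<le> ?M"
  proof -
    consider "x = 0" | "y = 0" | "x \<noteq> 0" "y \<noteq> 0" by blast
    then show ?thesis
    proof cases
      case 1
      then have "corner12 n x = 0" by (simp add: corner12_zero)
      then show ?thesis using A0_norm_upper[OF m b y] M by (simp add: pairing_zero_right[OF a])
    next
      case 2
      then have "corner12 m y = 0" by (simp add: corner12_zero)
      then show ?thesis using A0_norm_upper[OF n a x] M by (simp add: pairing_zero_right[OF b])
    next
      case 3
      have n2: "1 \<le> 2 * n" and m2: "1 \<le> 2 * m" using n m by auto
      obtain \<alpha> w where \<alpha>: "\<alpha> \<in> {0..1}" "w \<in> lead (K (2 * n))" "x = \<alpha> *\<^sub>R w"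
        using lead_decomposition[OF n2 x 3(1)] .
      obtain \<beta> z where \<beta>: "\<beta> \<in> {0..1}" "z \<in> lead (K (2 * m))" "y = \<beta> *\<^sub>R z"
        using lead_decomposition[OF m2 y 3(2)] .
      have "L3_cond K" using mc by (simp add: L1_matrix_convex_def)
      moreover have "0 \<in> mats (2 * n) (2 * m) (UNIV :: 'v set)" by (simp add: mats_def)
      ultimately have "\<alpha> + \<beta> \<le> 1"
        using xy x y n2 m2 \<alpha> \<beta> unfolding L3_cond_def by blast
      have "w \<in> K (2 * n)" "z \<in> K (2 * m)" using \<alpha>(2) \<beta>(2) unfolding lead_def by blast+
      then have "2 * cmod (pairing K n a (corner12 n x)) + 2 * cmod (pairing K m b (corner12 m y))
          \<le> \<alpha> * A0_norm K n a + \<beta> * A0_norm K m b"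
        using A0_norm_upper_scale[OF n a, of w \<alpha>] A0_norm_upper_scale[OF m b, of z \<beta>] \<alpha>(1,3) \<beta>(1,3)
        by (metis add_mono atLeastAtMost_iff)
      also have "\<dots> \<le> \<alpha> * ?M + \<beta> * ?M"
        using \<alpha>(1) \<beta>(1) M by (intro add_mono mult_left_mono) simp_all
      also have "\<dots> = (\<alpha> + \<beta>) * ?M" by (simp add: algebra_simps)
      also have "\<dots> \<le> 1 * ?M"
        using \<open>\<alpha> + \<beta> \<le> 1\<close> M(3) by (rule mult_right_mono)
      finally show ?thesis by simp
    qed
  qed
  then show "2 * Re (pairing K (n + m) (dsum n a b) (corner12 (n + m) u)) \<le> ?M"
    using complex_Re_le_cmod[of "pairing K n a (corner12 n x)"] complex_Re_le_cmod[of "pairing K m b (corner12 m y)"]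
    unfolding split by simp
qed

section \<open>Multiplication by scalar matrices\<close>

lemma ext_sum_left: "(\<And>i. i \<in> I \<Longrightarrow> f i \<in> W) \<Longrightarrow> e (\<Sum>i\<in>I. f i) v = (\<Sum>i\<in>I. e (f i) v)"
proof (induction I rule: infinite_finite_induct)
  case (insert i I)
  then have "(\<Sum>i\<in>I. f i) \<in> W" by (intro cvs.subspace_sum[OF subspace_A0_V]) auto
  then have "e (f i + (\<Sum>i\<in>I. f i)) v = e (f i) v + e (\<Sum>i\<in>I. f i) v"
    using A0_V_add insert.prems by (metis insertI1)
  then show ?case using insert by (simp only: sum.insert[OF insert.hyps] insert_iff simp_thms)
qed (auto simp: ext_zero_left)

lemma sandwich_mats:
  assumes a: "a \<in> mats m m W" and \<alpha>: "\<alpha> \<in> mats n m UNIV" and \<beta>: "\<beta> \<in> mats m n UNIV"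
  shows "sandwich m \<alpha> a \<beta> \<in> mats n n W"
proof -
  have "sandwich m \<alpha> a \<beta> i j \<in> W" for i j
    unfolding sandwich_def using mats_W_sub[OF a]
    by (intro cvs.subspace_sum[OF subspace_A0_V] cvs.subspace_scale[OF subspace_A0_V])
  moreover have "sandwich m \<alpha> a \<beta> i j = 0" if "\<not> (i < n \<and> j < n)" for i j
    unfolding sandwich_def
    by (intro sum.neutral ballI) (use that \<alpha> \<beta> in \<open>auto simp: mats_def\<close>)
  ultimately show ?thesis unfolding mats_def by blast
qed

lemma sum_swap3:
  "(\<Sum>j\<in>B. \<Sum>k\<in>C. \<Sum>l\<in>D. G j k l) = (\<Sum>k\<in>C. \<Sum>l\<in>D. \<Sum>j\<in>B. G j k l :: complex)"
proof -
  have "(\<Sum>j\<in>B. \<Sum>k\<in>C. \<Sum>l\<in>D. G j k l) = (\<Sum>k\<in>C. \<Sum>j\<in>B. \<Sum>l\<in>D. G j k l)" by (rule sum.swap)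
  also have "\<dots> = (\<Sum>k\<in>C. \<Sum>l\<in>D. \<Sum>j\<in>B. G j k l)" by (intro sum.cong refl sum.swap)
  finally show ?thesis .
qed

lemma sum_swap4:
  "(\<Sum>i\<in>A. \<Sum>j\<in>B. \<Sum>k\<in>C. \<Sum>l\<in>D. F i j k l) = (\<Sum>k\<in>C. \<Sum>l\<in>D. \<Sum>i\<in>A. \<Sum>j\<in>B. F i j k l :: complex)"
proof -
  have "(\<Sum>i\<in>A. \<Sum>j\<in>B. \<Sum>k\<in>C. \<Sum>l\<in>D. F i j k l) = (\<Sum>i\<in>A. \<Sum>k\<in>C. \<Sum>l\<in>D. \<Sum>j\<in>B. F i j k l)"
    by (intro sum.cong refl sum_swap3)
  also have "\<dots> = (\<Sum>k\<in>C. \<Sum>l\<in>D. \<Sum>i\<in>A. \<Sum>j\<in>B. F i j k l)"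
    by (rule sum_swap3)
  finally show ?thesis .
qed

text \<open>
  The transposed scalar matrices move to the other argument of the pairing.
\<close>

lemma pairing_sandwich:
  assumes a: "a \<in> mats m m W"
  shows "pairing K n (sandwich m \<alpha> a \<beta>) v = pairing K m a (sandwich n (\<lambda>i j. \<alpha> j i) v (\<lambda>i j. \<beta> j i))"
proof -
  note aW = mats_W_sub[OF a] A0_V_scale[OF mats_W_sub[OF a]]
  have "e (sandwich m \<alpha> a \<beta> i j) x = (\<Sum>k<m. \<Sum>l<m. \<alpha> i k * \<beta> l j * e (a k l) x)" for i j x
  proof -
    have "e (sandwich m \<alpha> a \<beta> i j) x = (\<Sum>k<m. e (\<Sum>l<m. (\<alpha> i k * \<beta> l j) *\<^sub>C a k l) x)"
      unfolding sandwich_def by (rule ext_sum_left) (use aW in \<open>auto intro: cvs.subspace_sum[OF subspace_A0_V]\<close>)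
    also have "\<dots> = (\<Sum>k<m. \<Sum>l<m. e ((\<alpha> i k * \<beta> l j) *\<^sub>C a k l) x)"
      using aW by (intro sum.cong refl ext_sum_left) auto
    finally show ?thesis using aW by simp
  qed
  then have "pairing K n (sandwich m \<alpha> a \<beta>) v
      = (\<Sum>i<n. \<Sum>j<n. \<Sum>k<m. \<Sum>l<m. \<alpha> i k * \<beta> l j * e (a k l) (v i j))"
    by (simp add: pairing_def)
  also have "\<dots> = (\<Sum>k<m. \<Sum>l<m. \<Sum>i<n. \<Sum>j<n. \<alpha> i k * \<beta> l j * e (a k l) (v i j))"
    by (rule sum_swap4)
  also have "\<dots> = pairing K m a (sandwich n (\<lambda>i j. \<alpha> j i) v (\<lambda>i j. \<beta> j i))"
    using aW by (simp add: pairing_def sandwich_def ext_sum_right ext_scale_right)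
  finally show ?thesis .
qed

text \<open>
  By \<open>pairing_sandwich\<close> the corner $u_{12}$ has to be replaced by $\alpha^T u_{12} \beta^T$. This is, up to the
  factor $\|\alpha\| \|\beta\|$, the corner of $\gamma^* u \gamma$ for the contraction
  $\gamma = \mathrm{diag}(\bar\alpha / \|\alpha\|, \beta^T / \|\beta\|)$.
\<close>

lemma A0_norm_sandwich_pos:
  assumes n: "1 \<le> n" and a: "a \<in> mats n n W" and \<alpha>: "\<alpha> \<in> mats n n UNIV" and \<beta>: "\<beta> \<in> mats n n UNIV"
    and A: "op_norm n \<alpha> \<noteq> 0" and B: "op_norm n \<beta> \<noteq> 0"
  shows "A0_norm K n (sandwich n \<alpha> a \<beta>) \<le> op_norm n \<alpha> * A0_norm K n a * op_norm n \<beta>"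
proof (rule A0_norm_least[OF n sandwich_mats[OF a \<alpha> \<beta>]])
  fix u assume u: "u \<in> K (2 * n)"
  define A where "A = op_norm n \<alpha>"
  define B where "B = op_norm n \<beta>"
  have AB: "A > 0" "B > 0" using assms op_norm_nonneg[of n] by (auto simp: A_def B_def order_less_le)
  define \<gamma> where "\<gamma> i k = (if i < n \<and> k < n then cnj (\<alpha> i k) / of_real A
      else if n \<le> i \<and> n \<le> k \<and> i < 2 * n \<and> k < 2 * n then \<beta> (k - n) (i - n) / of_real B else 0)" for i k
  have \<gamma>: "\<gamma> \<in> mats (2 * n) (2 * n) UNIV" by (auto simp: \<gamma>_def mats_def)
  have n2: "1 \<le> 2 * n" using n by simp
  define v where "v = sandwich (2 * n) (adj cnj \<gamma>) u \<gamma>"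
  have v: "v \<in> K (2 * n)"
    unfolding v_def
  proof (rule compress[OF n2 n2 u \<gamma>])
    fix x :: "nat \<Rightarrow> complex"
    have "(\<Sum>k<2 * n. (cmod (\<Sum>i<2 * n. cnj (\<gamma> i k) * x i))\<^sup>2)
        = (\<Sum>k<n. (cmod ((\<Sum>i<n. \<alpha> i k * x i) / of_real A))\<^sup>2)
          + (\<Sum>l<n. (cmod (cnj (\<Sum>i<n. \<beta> l i * cnj (x (n + i))) / of_real B))\<^sup>2)"
      unfolding mult_2 sum_lessThan_add
      by (intro arg_cong2[where f = "(+)"] sum.cong refl arg_cong[where f = "\<lambda>z. (cmod z)\<^sup>2"])
        (simp_all add: \<gamma>_def sum_divide_distrib)
    also have "\<dots> = (\<Sum>k<n. (cmod (\<Sum>i<n. \<alpha> i k * x i))\<^sup>2) / A\<^sup>2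
          + (\<Sum>l<n. (cmod (\<Sum>i<n. \<beta> l i * cnj (x (n + i))))\<^sup>2) / B\<^sup>2"
    proof -
      have "(cmod (z / of_real A))\<^sup>2 = (cmod z)\<^sup>2 / A\<^sup>2" "(cmod (z / of_real B))\<^sup>2 = (cmod z)\<^sup>2 / B\<^sup>2" for z
        by (simp_all add: norm_divide power_divide)
      then show ?thesis by (simp only: complex_mod_cnj flip: sum_divide_distrib)
    qed
    also have "\<dots> \<le> (\<Sum>i<n. (cmod (x i))\<^sup>2) + (\<Sum>i<n. (cmod (x (n + i)))\<^sup>2)"
      using op_norm_bound_transpose_sq[where n = n and A = \<alpha> and x = x]
        op_norm_bound_sq[where n = n and A = \<beta> and x = "\<lambda>i. cnj (x (n + i))"] AB
      by (intro add_mono) (simp_all add: A_def B_def field_simps)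
    also have "\<dots> = (\<Sum>i<2 * n. (cmod (x i))\<^sup>2)"
      unfolding mult_2 sum_lessThan_add ..
    finally show "(\<Sum>k<2 * n. (cmod (\<Sum>i<2 * n. cnj (\<gamma> i k) * x i))\<^sup>2) \<le> (\<Sum>i<2 * n. (cmod (x i))\<^sup>2)" .
  qed
  define S where "S = sandwich n (\<lambda>i j. \<alpha> j i) (corner12 n u) (\<lambda>i j. \<beta> j i)"
  have "corner12 n v k l = (1 / of_real (A * B)) *\<^sub>C S k l" if "k < n" "l < n" for k l
  proof -
    have "corner12 n v k l = (\<Sum>i<n. \<Sum>j<n. (cnj (\<gamma> i k) * \<gamma> (n + j) (n + l)) *\<^sub>C u i (n + j))"
      using that unfolding corner12_def v_def sandwich_def adj_def mult_2 sum_lessThan_add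
      by (simp add: \<gamma>_def)
    also have "\<dots> = (\<Sum>i<n. \<Sum>j<n. (1 / of_real (A * B)) *\<^sub>C ((\<alpha> i k * \<beta> l j) *\<^sub>C u i (n + j)))"
      using that by (intro sum.cong refl) (simp add: \<gamma>_def scaleC_scaleC)
    finally show ?thesis
      by (simp add: S_def sandwich_def corner12_def cvs.scale_sum_right)
  qed
  then have "pairing K n a (corner12 n v) = pairing K n a ((1 / of_real (A * B)) *\<^sub>C S)"
    by (intro pairing_cong) (simp add: scaleC_fun_apply)
  then have "pairing K n a S = of_real (A * B) * pairing K n a (corner12 n v)"
    using AB by (simp add: pairing_scale_right[OF a])
  then have "2 * cmod (pairing K n a S) = A * B * (2 * cmod (pairing K n a (corner12 n v)))"
    using AB by (simp add: norm_mult)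
  also have "\<dots> \<le> A * B * A0_norm K n a"
    using AB by (intro mult_left_mono A0_norm_upper[OF n a v]) simp
  finally show "2 * Re (pairing K n (sandwich n \<alpha> a \<beta>) (corner12 n u))
      \<le> op_norm n \<alpha> * A0_norm K n a * op_norm n \<beta>"
    using complex_Re_le_cmod[of "pairing K n a S"]
    by (simp add: pairing_sandwich[OF a] S_def A_def B_def mult_ac)
qed

lemma A0_norm_sandwich:
  assumes n: "1 \<le> n" and a: "a \<in> mats n n W" and \<alpha>: "\<alpha> \<in> mats n n UNIV" and \<beta>: "\<beta> \<in> mats n n UNIV"
  shows "A0_norm K n (sandwich n \<alpha> a \<beta>) \<le> op_norm n \<alpha> * A0_norm K n a * op_norm n \<beta>"
proof (cases "op_norm n \<alpha> = 0 \<or> op_norm n \<beta> = 0")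
  case True
  have "sandwich n \<alpha> a \<beta> = 0"
  proof (intro ext)
    fix i j x
    have "sandwich n \<alpha> a \<beta> i j = 0"
    proof (cases "i < n \<and> j < n")
      case ij: True
      have "\<alpha> i k * \<beta> l j = 0" if "k < n" "l < n" for k l
        using True op_norm_zero_entry ij that by (metis mult_eq_0_iff)
      then show ?thesis unfolding sandwich_def by (intro sum.neutral ballI) simp
    next
      case False
      then show ?thesis using sandwich_mats[OF a \<alpha> \<beta>] unfolding mats_def by blast
    qed
    then show "sandwich n \<alpha> a \<beta> i j x = (0 :: ('v \<Rightarrow> complex) mtx) i j x" by simp
  qed
  then show ?thesis using True A0_norm_zero[OF n] by (metis mult_zero_left mult_zero_right order_refl)
next
  case False
  then show ?thesis using A0_norm_sandwich_pos[OF assms] by blast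
qed

lemma operator_space_A0: "operator_space W (A0_norm K)"
  unfolding operator_space_def
proof (intro conjI allI impI ballI)
  show "cvs.subspace W" by (rule subspace_A0_V)
qed (simp_all only: norm_on_A0 A0_norm_sandwich antisym[OF A0_norm_dsum_le A0_norm_dsum_ge])

section \<open>The matrix order\<close>

lemma star_vector_space_A0: "star_vector_space W fun_star"
  unfolding star_vector_space_def
  by (auto simp: subspace_A0_V A0_V_star)
    (auto simp: fun_star_def fun_eq_iff scaleC_fun_apply scaleC_complex_def)

lemma A0_pos_iff:
  "a \<in> A0_pos K n \<longleftrightarrow> a \<in> mats n n W \<and> adj fun_star a = a \<and> (\<forall>v\<in>K n. pairing K n a v \<in> \<real>\<^sub>\<ge>\<^sub>0)"
  by (auto simp: A0_pos_def sa_mats_def)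

lemma cone_A0: "is_cone (sa_mats fun_star n W) (A0_pos K n)"
  unfolding is_cone_def
proof (intro conjI ballI allI impI)
  show "A0_pos K n \<subseteq> sa_mats fun_star n W" by (auto simp: A0_pos_def)
next
  fix a b assume a: "a \<in> A0_pos K n" and b: "b \<in> A0_pos K n"
  have "adj fun_star (a + b) = adj fun_star a + adj fun_star b"
    by (simp add: adj_def fun_star_def fun_eq_iff)
  then show "a + b \<in> A0_pos K n"
    using a b by (auto simp: A0_pos_iff mats_W_add pairing_add_left)
next
  fix a and r :: real assume a: "a \<in> A0_pos K n" and r: "0 \<le> r"
  have "adj fun_star (of_real r *\<^sub>C a) = of_real r *\<^sub>C adj fun_star a"
    by (simp add: adj_def fun_star_def fun_eq_iff scaleC_fun_apply scaleC_complex_def)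
  then show "r *\<^sub>R a \<in> A0_pos K n"
    unfolding scaleR_scaleC using a r by (auto simp: A0_pos_iff mats_W_scale pairing_scale_left)
qed

text \<open>
  Moving $\gamma$ to the other side of the pairing replaces $u \in K_n$ by its sandwich with $\gamma^T$, which
  is in \<open>K m\<close> after scaling $\gamma^T$ down to a contraction; positivity is insensitive to the scaling.
\<close>

lemma sandwich_pos:
  assumes m: "1 \<le> m" and n: "1 \<le> n" and \<gamma>: "\<gamma> \<in> mats m n UNIV" and a: "a \<in> A0_pos K m"
  shows "sandwich m (adj cnj \<gamma>) a \<gamma> \<in> A0_pos K n"
proof -
  from a have aW: "a \<in> mats m m W" and sa: "adj fun_star a = a"
    and pos: "\<And>v. v \<in> K m \<Longrightarrow> pairing K m a v \<in> \<real>\<^sub>\<ge>\<^sub>0"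
    by (auto simp: A0_pos_iff)
  have "adj cnj \<gamma> \<in> mats n m UNIV" using \<gamma> by (auto simp: adj_def mats_def)
  then have sW: "sandwich m (adj cnj \<gamma>) a \<gamma> \<in> mats n n W"
    using aW \<gamma> by (intro sandwich_mats)
  have "cnj (a i j x) = a j i x" for i j x
    using sa by (metis adj_def fun_star_def)
  then have "adj fun_star (sandwich m (adj cnj \<gamma>) a \<gamma>) i j x = sandwich m (adj cnj \<gamma>) a \<gamma> i j x" for i j x
    unfolding adj_def fun_star_def sandwich_def sum_fun_apply scaleC_fun_apply scaleC_complex_def
    by (simp add: mult_ac) (rule sum.swap)
  then have s_sa: "adj fun_star (sandwich m (adj cnj \<gamma>) a \<gamma>) = sandwich m (adj cnj \<gamma>) a \<gamma>"
    by (intro ext)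
  have "pairing K n (sandwich m (adj cnj \<gamma>) a \<gamma>) u \<in> \<real>\<^sub>\<ge>\<^sub>0" if u: "u \<in> K n" for u
  proof -
    \<comment> \<open>the squared Hilbert-Schmidt norm bounds the squared operator norm; adding 1 keeps the divisor positive\<close>
    define D where "D = 1 + (\<Sum>k<m. \<Sum>i<n. (cmod (\<gamma> k i))\<^sup>2)"
    have D: "D \<ge> 1" by (auto simp: D_def intro!: sum_nonneg)
    define \<delta> where "\<delta> i k = \<gamma> k i / of_real (sqrt D)" for i k
    have "\<delta> \<in> mats n m UNIV" using \<gamma> by (auto simp: \<delta>_def mats_def)
    then have "sandwich n (adj cnj \<delta>) u \<delta> \<in> K m"
    proof (rule compress[OF n m u])
      fix x :: "nat \<Rightarrow> complex"
      have "(cmod (\<Sum>i<n. cnj (\<delta> i k) * x i))\<^sup>2 \<le> (\<Sum>i<n. (cmod (\<gamma> k i))\<^sup>2) / D * (\<Sum>i<n. (cmod (x i))\<^sup>2)" for k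
      proof -
        have "cmod (\<Sum>i<n. cnj (\<delta> i k) * x i) \<le> (\<Sum>i<n. cmod (\<delta> i k) * cmod (x i))"
          by (rule order_trans[OF norm_sum]) (simp add: norm_mult)
        then have "(cmod (\<Sum>i<n. cnj (\<delta> i k) * x i))\<^sup>2 \<le> (\<Sum>i<n. cmod (\<delta> i k) * cmod (x i))\<^sup>2"
          by (intro power_mono) auto
        also have "\<dots> \<le> (\<Sum>i<n. (cmod (\<delta> i k))\<^sup>2) * (\<Sum>i<n. (cmod (x i))\<^sup>2)"
          by (rule Cauchy_Schwarz_ineq_sum)
        also have "(\<Sum>i<n. (cmod (\<delta> i k))\<^sup>2) = (\<Sum>i<n. (cmod (\<gamma> k i))\<^sup>2) / D"
          using D by (simp add: \<delta>_def norm_divide power_divide sum_divide_distrib)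
        finally show ?thesis .
      qed
      then have "(\<Sum>k<m. (cmod (\<Sum>i<n. cnj (\<delta> i k) * x i))\<^sup>2)
          \<le> (\<Sum>k<m. (\<Sum>i<n. (cmod (\<gamma> k i))\<^sup>2) / D * (\<Sum>i<n. (cmod (x i))\<^sup>2))"
        by (intro sum_mono)
      also have "\<dots> = (D - 1) / D * (\<Sum>i<n. (cmod (x i))\<^sup>2)"
        by (simp add: D_def sum_distrib_right sum_divide_distrib)
      also have "\<dots> \<le> 1 * (\<Sum>i<n. (cmod (x i))\<^sup>2)"
        using D by (intro mult_right_mono sum_nonneg) auto
      finally show "(\<Sum>k<m. (cmod (\<Sum>i<n. cnj (\<delta> i k) * x i))\<^sup>2) \<le> (\<Sum>i<n. (cmod (x i))\<^sup>2)" by simp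
    qed
    then have "of_real D * pairing K m a (sandwich n (adj cnj \<delta>) u \<delta>) \<in> \<real>\<^sub>\<ge>\<^sub>0"
      using D by (intro nonneg_Reals_mult_I pos) auto
    also have "of_real D * pairing K m a (sandwich n (adj cnj \<delta>) u \<delta>)
        = pairing K m a (of_real D *\<^sub>C sandwich n (adj cnj \<delta>) u \<delta>)"
      by (simp add: pairing_scale_right[OF aW])
    also have "of_real D *\<^sub>C sandwich n (adj cnj \<delta>) u \<delta> = sandwich n (\<lambda>i j. adj cnj \<gamma> j i) u (\<lambda>i j. \<gamma> j i)"
    proof (intro ext)
      fix k l
      have "of_real D * (cnj (\<delta> i k) * \<delta> j l) = cnj (\<gamma> k i) * \<gamma> l j" for i j
      proof -
        have "complex_of_real (sqrt D) * complex_of_real (sqrt D) = of_real D"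
          using D by (simp flip: of_real_mult)
        then show ?thesis using D by (simp add: \<delta>_def)
      qed
      then show "(of_real D *\<^sub>C sandwich n (adj cnj \<delta>) u \<delta>) k l = sandwich n (\<lambda>i j. adj cnj \<gamma> j i) u (\<lambda>i j. \<gamma> j i) k l"
        unfolding scaleC_fun_apply sandwich_def adj_def
        by (simp add: cvs.scale_sum_right scaleC_scaleC)
    qed
    finally show ?thesis by (simp add: pairing_sandwich[OF aW])
  qed
  then show ?thesis using sW s_sa by (simp add: A0_pos_iff)
qed

lemma matrix_ordered_A0: "matrix_ordered W fun_star (A0_pos K)"
  unfolding matrix_ordered_def using star_vector_space_A0 cone_A0 sandwich_pos by blast

lemma proper_A0: "proper (A0_pos K 1)"
proof -
  have "a = 0" if a: "a \<in> A0_pos K 1" and b: "b \<in> A0_pos K 1" and ab: "a = - b" for a b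
  proof -
    have aW: "a \<in> mats 1 1 W" and bW: "b \<in> mats 1 1 W" using a b by (auto simp: A0_pos_iff)
    have "a 0 0 = 0"
    proof (rule A0_V_zeroI)
      show "a 0 0 \<in> W" using aW by (rule mats_W_sub)
      fix v assume "v \<in> base K"
      then obtain w where w: "w \<in> K 1" "v = w 0 0" by (auto simp: base_def)
      have "pairing K 1 a w = - pairing K 1 b w"
        using pairing_scale_left[OF bW, of "- 1" w] ab by (simp add: cvs.scale_minus_left scaleC_one)
      moreover have "pairing K 1 a w \<in> \<real>\<^sub>\<ge>\<^sub>0" "pairing K 1 b w \<in> \<real>\<^sub>\<ge>\<^sub>0"
        using a b w by (auto simp: A0_pos_iff)
      ultimately have "pairing K 1 a w = 0"
        by (auto simp: complex_nonneg_Reals_iff complex_eq_iff)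
      then show "e (a 0 0) v = 0" using w by (simp add: pairing_def)
    qed
    moreover have "a i j = 0" if "\<not> (i = 0 \<and> j = 0)" for i j
      using aW that by (auto simp: mats_def)
    ultimately have "a i j = 0" for i j by (cases "i = 0 \<and> j = 0") auto
    then show ?thesis by (intro ext) simp
  qed
  moreover have "0 \<in> A0_pos K 1"
    using mats_W_scale[of 0 1 0] cvs.subspace_0[OF subspace_A0_V]
    by (auto simp: A0_pos_iff pairing_zero_left mats_def adj_def fun_star_def fun_eq_iff)
  ultimately show ?thesis by (auto simp: proper_def intro!: image_eqI[of _ _ 0])
qed

section \<open>Compatibility of norm and order\<close>

text \<open>
  Swapping the two diagonal blocks of $u$ turns its corner into the adjoint.
\<close>

lemma A0_norm_adj_le:
  assumes n: "1 \<le> n" and a: "a \<in> mats n n W"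
  shows "A0_norm K n (adj fun_star a) \<le> A0_norm K n a"
proof (rule A0_norm_least[OF n mats_W_adj[OF a]])
  fix u assume u: "u \<in> K (2 * n)"
  have n2: "1 \<le> 2 * n" using n by simp
  define \<sigma> where "\<sigma> k = (if k < n then n + k else k - n)" for k
  define v where "v = (\<lambda>k l. if k < 2 * n \<and> l < 2 * n then (cnj 1 * 1) *\<^sub>C u (\<sigma> k) (\<sigma> l) else 0)"
  have v: "v \<in> K (2 * n)"
    unfolding v_def by (rule compress_inj[OF n2 n2 u]) (auto simp: \<sigma>_def inj_on_def split: if_splits)
  have "pairing K n a (adj star (corner12 n u)) = pairing K n a (corner12 n v)"
    by (rule pairing_cong) (auto simp: adj_def corner12_def v_def \<sigma>_def K_star[OF n2 u] scaleC_one)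
  then have "Re (pairing K n (adj fun_star a) (corner12 n u)) = Re (pairing K n a (corner12 n v))"
    using a by (simp add: pairing_adj)
  then show "2 * Re (pairing K n (adj fun_star a) (corner12 n u)) \<le> A0_norm K n a"
    using A0_norm_upper[OF n a v] complex_Re_le_cmod[of "pairing K n a (corner12 n v)"] by simp
qed

lemma A0_norm_adj:
  assumes n: "1 \<le> n" and a: "a \<in> mats n n W"
  shows "A0_norm K n (adj fun_star a) = A0_norm K n a"
proof -
  have "adj fun_star (adj fun_star a) = a" by (simp add: adj_def fun_star_def)
  then show ?thesis
    using A0_norm_adj_le[OF n a] A0_norm_adj_le[OF n mats_W_adj[OF a]] by simp
qed

text \<open>
  The involution is isometric, so a limit of self-adjoint elements is at distance 0 from its adjoint;
  and each $\langle \cdot, v\rangle$ with $v \in K_n$ is continuous for the norm by \<open>A0_norm_bound\<close>.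
\<close>

lemma A0_pos_closed:
  assumes n: "1 \<le> n" and a: "a \<in> mats n n W"
    and lim: "\<And>\<epsilon>. \<epsilon> > 0 \<Longrightarrow> \<exists>w\<in>A0_pos K n. A0_norm K n (a - w) < \<epsilon>"
  shows "a \<in> A0_pos K n"
proof -
  have "A0_norm K n (a - adj fun_star a) \<le> 0 + \<epsilon>" if "\<epsilon> > 0" for \<epsilon>
  proof -
    obtain w where w: "w \<in> A0_pos K n" "A0_norm K n (a - w) < \<epsilon> / 2"
      using lim[of "\<epsilon> / 2"] \<open>\<epsilon> > 0\<close> by auto
    have wW: "w \<in> mats n n W" "adj fun_star w = w" using w by (auto simp: A0_pos_iff)
    have aw: "a - w \<in> mats n n W" using a wW by (intro mats_W_diff)
    have "adj fun_star (a - w) = adj fun_star a - w"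
      by (subst (2) wW(2)[symmetric]) (simp add: adj_def fun_star_def fun_eq_iff)
    then have "a - adj fun_star a = (a - w) + (- 1) *\<^sub>C adj fun_star (a - w)"
      by (simp add: cvs.scale_minus_left scaleC_one)
    then have "A0_norm K n (a - adj fun_star a) \<le> A0_norm K n (a - w) + A0_norm K n ((- 1) *\<^sub>C adj fun_star (a - w))"
      using A0_norm_triangle[OF n aw mats_W_scale[OF mats_W_adj[OF aw]]] by metis
    also have "\<dots> = A0_norm K n (a - w) + A0_norm K n (a - w)"
      using A0_norm_scale[OF n mats_W_adj[OF aw], of "- 1"] A0_norm_adj[OF n aw] by simp
    finally show ?thesis using w by simp
  qed
  then have "A0_norm K n (a - adj fun_star a) \<le> 0"
    by (rule field_le_epsilon)
  then have "a - adj fun_star a = 0"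
    using A0_norm_eq_zeroD[OF n mats_W_diff[OF a mats_W_adj[OF a]]] A0_norm_nonneg[OF n mats_W_diff[OF a mats_W_adj[OF a]]]
    by simp
  then have sa: "adj fun_star a = a" by simp
  have "pairing K n a v \<in> \<real>\<^sub>\<ge>\<^sub>0" if v: "v \<in> K n" for v
  proof -
    have "pairing K n a v \<in> closure \<real>\<^sub>\<ge>\<^sub>0"
      unfolding closure_approachable
    proof (intro allI impI)
      fix \<epsilon> :: real assume "\<epsilon> > 0"
      then obtain w where w: "w \<in> A0_pos K n" "A0_norm K n (a - w) < \<epsilon>" using lim by auto
      have wW: "w \<in> mats n n W" "pairing K n w v \<in> \<real>\<^sub>\<ge>\<^sub>0" using w v by (auto simp: A0_pos_iff)
      have "dist (pairing K n w v) (pairing K n a v) = cmod (pairing K n (a - w) v)"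
        by (simp add: dist_norm norm_minus_commute pairing_diff_left[OF a wW(1)])
      also have "\<dots> \<le> A0_norm K n (a - w)"
        by (rule A0_norm_bound[OF n mats_W_diff[OF a wW(1)] v])
      finally show "\<exists>y\<in>\<real>\<^sub>\<ge>\<^sub>0. dist y (pairing K n a v) < \<epsilon>" using w wW by force
    qed
    then show ?thesis by simp
  qed
  then show ?thesis using a sa by (simp add: A0_pos_iff)
qed

text \<open>
  The second condition is used here. As $g$ is self-adjoint, $2\,\mathrm{Re}\,\langle g, u_{12}\rangle =
  \langle g, u_{12} + u_{12}^*\rangle$, and the argument lies in the convex hull of $K_n \cup -K_n$. The half
  space where $\mathrm{Re}\,\langle g, \cdot\rangle$ is at most the claimed bound is convex, so it
  suffices to look at $x \in K_n$, where $g \le h$ applies, and at $-x$, where $f \le g$ applies.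
\<close>

lemma A0_norm_between:
  assumes n: "1 \<le> n"
    and f: "f \<in> sa_mats fun_star n W" and g: "g \<in> sa_mats fun_star n W" and h: "h \<in> sa_mats fun_star n W"
    and fg: "g - f \<in> A0_pos K n" and gh: "h - g \<in> A0_pos K n"
  shows "A0_norm K n g \<le> max (A0_norm K n f) (A0_norm K n h)" (is "_ \<le> ?M")
proof -
  have fW: "f \<in> mats n n W" and gW: "g \<in> mats n n W" and hW: "h \<in> mats n n W"
    and sa: "adj fun_star g = g"
    using f g h by (auto simp: sa_mats_def)
  show ?thesis
  proof (rule A0_norm_least[OF n gW])
    fix u assume u: "u \<in> K (2 * n)"
    have n2: "1 \<le> 2 * n" using n by simp
    define z where "z = corner12 n u + adj star (corner12 n u)"
    have "(\<lambda>k l. if k < n \<and> l < n then (cnj 1 * 1) *\<^sub>C u k l else 0) \<in> K n"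
      by (rule compress_inj[OF n2 n u]) auto
    then have up: "corner11 n u \<in> K n" by (simp add: corner11_def scaleC_one cong: if_cong)
    have "(\<lambda>k l. if k < n \<and> l < n then (cnj 1 * 1) *\<^sub>C u (n + k) (n + l) else 0) \<in> K n"
      by (rule compress_inj[OF n2 n u]) auto
    then have low: "corner22 n u \<in> K n" by (simp add: corner22_def scaleC_one cong: if_cong)
    have "L2_cond K" using mc by (simp add: L1_matrix_convex_def)
    then have "z \<in> convex hull (K n \<union> uminus ` K n)"
      unfolding L2_cond_def z_def
      using n up low corner12_mats block_corners[OF n u] u by metis
    also have "\<dots> \<subseteq> {x. Re (pairing K n g x) \<le> ?M}"
    proof (rule hull_minimal)
      show "convex {x. Re (pairing K n g x) \<le> ?M}"
      proof (rule convexI)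
        fix x y and s t :: real
        assume "x \<in> {x. Re (pairing K n g x) \<le> ?M}" "y \<in> {x. Re (pairing K n g x) \<le> ?M}"
          and st: "0 \<le> s" "0 \<le> t" "s + t = 1"
        then have "s * Re (pairing K n g x) + t * Re (pairing K n g y) \<le> s * ?M + t * ?M"
          by (intro add_mono mult_left_mono) auto
        also have "\<dots> = ?M" using st by (simp flip: distrib_right)
        finally show "s *\<^sub>R x + t *\<^sub>R y \<in> {x. Re (pairing K n g x) \<le> ?M}"
          unfolding scaleR_scaleC by (simp add: pairing_add_right[OF gW] pairing_scale_right[OF gW])
      qed
      show "K n \<union> uminus ` K n \<subseteq> {x. Re (pairing K n g x) \<le> ?M}"
      proof safe
        fix x assume x: "x \<in> K n"
        have "pairing K n (h - g) x \<in> \<real>\<^sub>\<ge>\<^sub>0" "pairing K n (g - f) x \<in> \<real>\<^sub>\<ge>\<^sub>0"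
          using fg gh x by (auto simp: A0_pos_iff)
        then have le: "Re (pairing K n g x) \<le> Re (pairing K n h x)" "Re (pairing K n f x) \<le> Re (pairing K n g x)"
          by (auto simp: complex_nonneg_Reals_iff pairing_diff_left fW gW hW)
        show "Re (pairing K n g x) \<le> ?M"
          using le(1) A0_norm_bound[OF n hW x] complex_Re_le_cmod[of "pairing K n h x"] by linarith
        have "pairing K n g (- x) = - pairing K n g x"
          using pairing_scale_right[OF gW, of "- 1" x] by (simp add: cvs.scale_minus_left scaleC_one)
        then show "Re (pairing K n g (- x)) \<le> ?M"
          using le(2) A0_norm_bound[OF n fW x] abs_Re_le_cmod[of "pairing K n f x"] by simp
      qed
    qed
    finally have "Re (pairing K n g z) \<le> ?M" by simp
    moreover have "pairing K n g (adj star (corner12 n u)) = cnj (pairing K n g (corner12 n u))"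
      using pairing_adj[OF gW, of "corner12 n u"] sa by simp
    ultimately show "2 * Re (pairing K n g (corner12 n u)) \<le> ?M"
      by (simp add: z_def pairing_add_right[OF gW])
  qed
qed

lemma cstar_ordered: "cstar_ordered_operator_space W fun_star (A0_pos K) (A0_norm K)"
  unfolding cstar_ordered_operator_space_def
  using matrix_ordered_A0 operator_space_A0 proper_A0 A0_norm_adj A0_pos_closed A0_norm_between by blast

end

theorem theorem4p5:
  fixes K :: "nat \<Rightarrow> 'v::star_locally_convex mtx set"
  assumes "L1_matrix_convex K"
    and "\<forall>n\<ge>1. is_cone (sa_mats star n UNIV) (pos_mats K n)"
    and "proper (pos_mats K 1)"
    and "cvs.span (pos_mats K 1) = mats 1 1 UNIV"
  shows "cstar_ordered_operator_space (A0_V K) fun_star (A0_pos K) (A0_norm K)"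
proof -
  interpret L1_system K using assms by unfold_locales auto
  show ?thesis by (rule cstar_ordered)
qed

end
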